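(* Let $B$ be a finite clean bidirected graph rooted at $r$ and let $x\in V(B)\setminus\{r\}$ be such that there is no edge between $r$ and $x$. Then $$\kappa_B(r,x)=\min\left\{\left|\epsilon_{r,B}(X)\right| : \{x\}\cup\mathrm{In}_B(x)\subseteq X\subseteq V(B)\setminus\{r\}\right\}.$$
   Context: A bidirected graph $B=(G,\sigma)$ is a loopless multigraph $G$ together with a map $\sigma$ assigning to each half-edge $(e,u)$ ($u$ an endpoint of the edge $e$) a sign $\sigma(e,u)\in\{+,-\}$. An oriented edge $\vec e$ is an edge $e$ with a choice of which endpoint is its tail and which its head. A trail is a sequence $v_0\vec e_1v_1\dots\vec e_\ell v_\ell$ in which the edges $e_i$ are pairwise distinct, $\vec e_i$ has tail $v_{i-1}$ and head $v_i$, and $\sigma(e_{i+1},v_i)=-\sigma(e_i,v_i)$ for $1\le i<\ell$; it is a $v_0$--$v_\ell$ trail, trivial if $\ell=0$. A path is a trail that does not repeat vertices. An almost path is a trail that is trivial or becomes a path on removing its last edge (and last vertex). $B$ is rooted if it has a designated root vertex $r$; it is clean if there is no nontrivial $r$--$r$ almost path. An $r$--$\vec e$ path is a path starting in $r$ whose last oriented edge is $\vec e$. $\kappa_B(v,w)$ is the maximum number of pairwise internally vertex-disjoint (distinct) $v$--$w$ paths in $B$. $\mathrm{In}_B(x)$ is the set of $v\in V(B)\setminus\{r,x\}$ such that there is an $r$--$x$ path with second to last vertex $v$. For $X\subseteq V(B)\setminus\{r\}$, $\epsilon_{r,B}(X)$ is the set of vertices $v\in X$ for which there is an oriented edge $\vec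 e$ of $B$ with head $v$ and tail not in $X$ such that there exists an $r$--$\vec e$ path in $B$. *)

theory Defs
  imports Main
begin

datatype sign = Plus | Minus

fun opposite :: "sign \<Rightarrow> sign" where
  "opposite Plus = Minus"
| "opposite Minus = Plus"

text \<open>
  Parallel edges are allowed: distinct edge names may have the same endpoints.
  The value \<open>sign_of B e u\<close> is the sign of the half-edge \<open>(e,u)\<close>; it is
  irrelevant when \<open>u\<close> is not an endpoint of \<open>e\<close>.
\<close>

record ('v, 'e) bidirected =
  verts :: "'v set"
  edges :: "'e set"
  endpoints :: "'e \<Rightarrow> 'v set"
  sign_of :: "'e \<Rightarrow> 'v \<Rightarrow> sign"

locale bidirected_graph =
  fixes B :: "('v, 'e) bidirected"
  assumes endpoints_subset: "e \<in> edges B \<Longrightarrow> endpoints B e \<subseteq> verts B"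
    and loopless: "e \<in> edges B \<Longrightarrow> card (endpoints B e) = 2"

locale finite_rooted_bidirected_graph = bidirected_graph B
  for B :: "('v, 'e) bidirected" and r :: 'v +
  assumes finite_verts: "finite (verts B)"
    and finite_edges: "finite (edges B)"
    and root: "r \<in> verts B"

datatype ('v, 'e) oedge = Oriented (edge: 'e) (tail: 'v) (head: 'v)

definition oriented_edge :: "('v, 'e) bidirected \<Rightarrow> ('v, 'e) oedge \<Rightarrow> bool" where
  "oriented_edge B f \<longleftrightarrow> edge f \<in> edges B \<and> endpoints B (edge f) = {tail f, head f}"

text \<open>
  The sequence \<open>v\<^sub>0 e\<^sub>1 v\<^sub>1 \<dots> e\<^sub>l v\<^sub>l\<close> is represented by the
  vertex list \<open>[v\<^sub>0, \<dots>, v\<^sub>l]\<close> paired with the list of oriented edges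
  \<open>[e\<^sub>1, \<dots>, e\<^sub>l]\<close>. Note the index shift: \<open>e\<^sub>i\<^sub>+\<^sub>1\<close> is entry \<open>i\<close> of
  the second list.
\<close>

type_synonym ('v, 'e) walk = "'v list \<times> ('v, 'e) oedge list"

definition trail :: "('v, 'e) bidirected \<Rightarrow> ('v, 'e) walk \<Rightarrow> bool" where
  "trail B p \<longleftrightarrow> (case p of (vs, fs) \<Rightarrow>
     length vs = Suc (length fs) \<and>
     set vs \<subseteq> verts B \<and>
     distinct (map edge fs) \<and>
     (\<forall>i<length fs. oriented_edge B (fs ! i) \<and>
        tail (fs ! i) = vs ! i \<and> head (fs ! i) = vs ! Suc i) \<and>
     (\<forall>i. 1 \<le> i \<and> i < length fs \<longrightarrow>
        sign_of B (edge (fs ! i)) (vs ! i) =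
          opposite (sign_of B (edge (fs ! (i - 1))) (vs ! i))))"

definition path :: "('v, 'e) bidirected \<Rightarrow> ('v, 'e) walk \<Rightarrow> bool" where
  "path B p \<longleftrightarrow> trail B p \<and> distinct (fst p)"

definition trivial :: "('v, 'e) walk \<Rightarrow> bool" where
  "trivial p \<longleftrightarrow> snd p = []"

definition almost_path :: "('v, 'e) bidirected \<Rightarrow> ('v, 'e) walk \<Rightarrow> bool" where
  "almost_path B p \<longleftrightarrow>
     trail B p \<and> (trivial p \<or> path B (butlast (fst p), butlast (snd p)))"

definition joins :: "('v, 'e) walk \<Rightarrow> 'v \<Rightarrow> 'v \<Rightarrow> bool" where
  "joins p v w \<longleftrightarrow> hd (fst p) = v \<and> last (fst p) = w"

definition clean :: "('v, 'e) bidirected \<Rightarrow> 'v \<Rightarrow> bool" where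
  "clean B r \<longleftrightarrow> \<not> (\<exists>p. almost_path B p \<and> joins p r r \<and> \<not> trivial p)"

definition path_to_edge ::
    "('v, 'e) bidirected \<Rightarrow> 'v \<Rightarrow> ('v, 'e) oedge \<Rightarrow> ('v, 'e) walk \<Rightarrow> bool" where
  "path_to_edge B r f p \<longleftrightarrow>
     path B p \<and> hd (fst p) = r \<and> \<not> trivial p \<and> last (snd p) = f"

definition internal_verts :: "('v, 'e) walk \<Rightarrow> 'v set" where
  "internal_verts p = set (butlast (tl (fst p)))"

text \<open>
  Since \<open>P\<close> is a set, its members are distinct paths; paths are compared as
  sequences including their edges. The maximum is only meaningful for finite \<open>B\<close>.
\<close>

definition kappa :: "('v, 'e) bidirected \<Rightarrow> 'v \<Rightarrow> 'v \<Rightarrow> nat" where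
  "kappa B v w = Max {card P | P.
     finite P \<and> (\<forall>p\<in>P. path B p \<and> joins p v w) \<and>
     pairwise (\<lambda>p q. internal_verts p \<inter> internal_verts q = {}) P}"

definition In_set :: "('v, 'e) bidirected \<Rightarrow> 'v \<Rightarrow> 'v \<Rightarrow> 'v set" where
  "In_set B r x = {v \<in> verts B - {r, x}.
     \<exists>p. path B p \<and> joins p r x \<and> \<not> trivial p \<and> last (butlast (fst p)) = v}"

definition epsilon :: "('v, 'e) bidirected \<Rightarrow> 'v \<Rightarrow> 'v set \<Rightarrow> 'v set" where
  "epsilon B r X = {v \<in> X.
     \<exists>f. oriented_edge B f \<and> head f = v \<and> tail f \<notin> X \<and> (\<exists>p. path_to_edge B r f p)}"

end

theory Submission
  imports Defs
begin

text \<open>Grow Edmonds' blossoms from the root: cleanness means that two branches never meet through an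
  edge without a common base, so a maximal family of blossoms is closed under taking further
  edges. Every path from \<open>r\<close> then enters each blossom through its base only, and from the base
  all other states of the blossom are reachable inside it. Contracting the blossoms therefore
  turns disjoint \<open>r\<close>--\<open>x\<close> paths into disjoint paths of a digraph on the bases, where the vertex
  version of Menger's theorem provides a separator \<open>S\<close>; the set \<open>X\<close> consists of the vertices whose
  blossom is not reachable in the digraph without meeting \<open>S\<close> or \<open>x\<close>. If \<open>x\<close> is not a base, its
  blossom is itself an optimal \<open>X\<close>.\<close>

text \<open>Menger's theorem does not apply to the states directly. A path of \<open>B\<close> may
  use only one of the two states of a vertex, whereas a digraph path may use both, and two paths
  that meet at a vertex can be recombined only if their signs fit. Contraction removes this
  obstacle: a non-base is available in both states and a base in a single one, so signs play no part
  between bases, and disjoint digraph paths lift to disjoint paths of \<open>B\<close>. Cleanness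
  keeps the root from becoming the base of a blossom; such a blossom could be entered at several
  vertices at once, and the bottleneck at the base would be lost. The condition on \<open>X\<close>
  comes from the other inequality. Each path has to meet \<open>epsilon B r X\<close> in an internal
  vertex, since the end \<open>x\<close> is shared by all paths. Having \<open>In_set B r x\<close>
  inside \<open>X\<close> makes a path enter \<open>X\<close> before it reaches \<open>x\<close>,
  and the absence of an edge between \<open>r\<close> and \<open>x\<close> excludes the only path
  left over.\<close>

section \<open>Menger's theorem for digraphs\<close>

definition walk :: "('a \<times> 'a) set \<Rightarrow> 'a set \<Rightarrow> 'a set \<Rightarrow> 'a list \<Rightarrow> bool" where
  "walk E A T p \<longleftrightarrow> p \<noteq> [] \<and> hd p \<in> A \<and> last p \<in> T \<and> successively (\<lambda>u v. (u, v) \<in> E) p"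

definition separates :: "('a \<times> 'a) set \<Rightarrow> 'a set \<Rightarrow> 'a set \<Rightarrow> 'a set \<Rightarrow> bool" where
  "separates E A T S \<longleftrightarrow> (\<forall>p. walk E A T p \<longrightarrow> set p \<inter> S \<noteq> {})"

definition disjoint_paths :: "('a \<times> 'a) set \<Rightarrow> 'a set \<Rightarrow> 'a set \<Rightarrow> 'a list set \<Rightarrow> bool" where
  "disjoint_paths E A T \<P> \<longleftrightarrow> finite \<P> \<and> (\<forall>p\<in>\<P>. walk E A T p \<and> distinct p) \<and>
     pairwise (\<lambda>p q. set p \<inter> set q = {}) \<P>"

text \<open>The implication is asked only at places of the list, with the place visible: a cut walk
  avoids the deleted edge because of where an endpoint of that edge can occur on it.\<close>

lemma successively_subset:
  assumes "successively P p" "\<And>xs u v ys. p = xs @ u # v # ys \<Longrightarrow> P u v \<Longrightarrow> Q u v"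
  shows "successively Q p"
  using assms
proof (induction p rule: induct_list012)
  case (3 u v ys)
  have "Q u v" using 3(3) 3(4)[of "[]" u v ys] by simp
  moreover have "successively Q (v # ys)"
  proof (rule 3(2))
    show "successively P (v # ys)" using 3(3) by simp
    show "Q a c" if "v # ys = xs @ a # c # zs" "P a c" for xs a c zs
      using 3(4)[of "u # xs" a c zs] that by simp
  qed
  ultimately show ?case by simp
qed auto

lemma walk_mono: "walk E A T p \<Longrightarrow> E \<subseteq> E' \<Longrightarrow> walk E' A T p"
  unfolding walk_def by (auto elim: successively_mono)

lemma walk_set:
  assumes "walk E A T p"
  shows "set p \<subseteq> A \<union> Range E"
proof
  fix c assume "c \<in> set p"
  then obtain i where "c = p ! i" "i < length p" by (auto simp: in_set_conv_nth)
  then show "c \<in> A \<union> Range E" using assms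
    by (cases i) (auto simp: walk_def hd_conv_nth successively_conv_nth)
qed

lemma walk_append_tl:
  assumes "walk E A P p" "walk E Q T q" "last p = hd q"
  shows "walk E A T (p @ tl q)"
  using assms by (cases q) (auto simp: walk_def successively_append_iff successively_Cons last_append)

lemma walk_prefix:
  assumes "walk E A T (p1 @ z # p2)"
  shows "walk E A {z} (p1 @ [z])"
  using assms by (auto simp: walk_def successively_append_iff hd_append)

lemma walk_suffix:
  assumes "walk E A T (p1 @ z # p2)"
  shows "walk E {z} T (z # p2)"
  using assms by (auto simp: walk_def successively_append_iff)

text \<open>Cut a walk at its first vertex in \<open>P\<close>. No vertex before the cut is
  \<open>x\<close>, so the initial piece does not use \<open>(x, y)\<close> and the separator of the
  smaller digraph applies to it.\<close>

lemma separates_upto_first: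
  assumes "separates E A T P" "x \<in> P" "separates (E - {(x, y)}) A P S"
  shows "separates E A T S"
  unfolding separates_def
proof (intro allI impI)
  fix p assume p: "walk E A T p"
  then have "\<exists>z\<in>set p. z \<in> P" using assms(1) by (auto simp: separates_def)
  then obtain p1 z p2 where z: "p = p1 @ z # p2" "z \<in> P" "\<forall>w\<in>set p1. w \<notin> P"
    using split_list_first_prop[of p "\<lambda>z. z \<in> P"] by blast
  have w: "walk E A {z} (p1 @ [z])" using p z(1) walk_prefix by metis
  have "successively (\<lambda>u v. (u, v) \<in> E - {(x, y)}) (p1 @ [z])"
  proof (rule successively_subset)
    show "successively (\<lambda>u v. (u, v) \<in> E) (p1 @ [z])" using w by (simp add: walk_def)
    fix xs u v ys assume eq: "p1 @ [z] = xs @ u # v # ys" and "(u, v) \<in> E"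
    have "butlast (p1 @ [z]) = xs @ u # butlast (v # ys)" unfolding eq by (simp add: butlast_append)
    then have "u \<in> set p1" by simp
    then have "u \<noteq> x" using z(3) assms(2) by auto
    then show "(u, v) \<in> E - {(x, y)}" using \<open>(u, v) \<in> E\<close> by auto
  qed
  then have "walk (E - {(x, y)}) A P (p1 @ [z])" using w z(2) by (simp add: walk_def)
  then show "set p \<inter> S \<noteq> {}" using assms(3) z(1) by (fastforce simp: separates_def)
qed

text \<open>Dually, no vertex after the last one in \<open>Q\<close> is \<open>y\<close>, so the
  final piece never enters \<open>y\<close> along the deleted edge.\<close>

lemma separates_from_last:
  assumes "separates E A T Q" "y \<in> Q" "separates (E - {(x, y)}) Q T S"
  shows "separates E A T S"
  unfolding separates_def
proof (intro allI impI)
  fix p assume p: "walk E A T p"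
  then have "\<exists>z\<in>set p. z \<in> Q" using assms(1) by (auto simp: separates_def)
  then obtain p1 z p2 where z: "p = p1 @ z # p2" "z \<in> Q" "\<forall>w\<in>set p2. w \<notin> Q"
    using split_list_last_prop[of p "\<lambda>z. z \<in> Q"] by blast
  have w: "walk E {z} T (z # p2)" using p z(1) walk_suffix by metis
  have "successively (\<lambda>u v. (u, v) \<in> E - {(x, y)}) (z # p2)"
  proof (rule successively_subset)
    show "successively (\<lambda>u v. (u, v) \<in> E) (z # p2)" using w by (simp add: walk_def)
    fix xs u v ys assume eq: "z # p2 = xs @ u # v # ys" and "(u, v) \<in> E"
    have "tl (z # p2) = tl (xs @ [u]) @ v # ys" unfolding eq by (cases xs) auto
    then have "v \<in> set p2" by simp
    then have "v \<noteq> y" using z(3) assms(2) by auto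
    then show "(u, v) \<in> E - {(x, y)}" using \<open>(u, v) \<in> E\<close> by auto
  qed
  then have "walk (E - {(x, y)}) Q T (z # p2)" using w z(2) by (simp add: walk_def)
  then show "set p \<inter> S \<noteq> {}" using assms(3) z(1) by (fastforce simp: separates_def)
qed

text \<open>Disjoint paths have distinct ends, so by counting the ends exhaust \<open>P\<close>. A
  second vertex of \<open>P\<close> on a path would be the end of another path, against
  disjointness.\<close>

lemma disjoint_paths_onto:
  assumes "disjoint_paths E A P \<P>" "finite P" "card \<P> = card P" and s: "s \<in> P"
  obtains p where "p \<in> \<P>" "set p \<inter> P = {s}" "last p = s"
proof -
  have disj: "set p \<inter> set q = {}" if "p \<in> \<P>" "q \<in> \<P>" "p \<noteq> q" for p q
    using assms(1) that by (auto simp: disjoint_paths_def pairwise_def)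
  have ne: "p \<noteq> []" "last p \<in> set p" "last p \<in> P" if "p \<in> \<P>" for p
    using assms(1) that by (auto simp: disjoint_paths_def walk_def)
  have "inj_on last \<P>"
    by (rule inj_onI) (metis disj ne(2) disjoint_iff)
  then have "last ` \<P> = P"
    using assms(2,3) ne(3) by (metis card_image card_subset_eq image_subsetI)
  then obtain p where p: "p \<in> \<P>" "last p = s" using s by auto
  have "z = s" if z: "z \<in> set p" "z \<in> P" for z
  proof -
    obtain q where "q \<in> \<P>" "last q = z" using \<open>last ` \<P> = P\<close> z(2) by auto
    then show ?thesis using disj[of p q] ne(2)[of q] p z(1) by (cases "p = q") auto
  qed
  then show ?thesis using that[of p] p ne s by blast
qed

lemma disjoint_paths_onto_hd:
  assumes "disjoint_paths E Q T \<P>" "finite Q" "card \<P> = card Q" and s: "s \<in> Q"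
  obtains p where "p \<in> \<P>" "set p \<inter> Q = {s}" "hd p = s"
proof -
  have disj: "set p \<inter> set q = {}" if "p \<in> \<P>" "q \<in> \<P>" "p \<noteq> q" for p q
    using assms(1) that by (auto simp: disjoint_paths_def pairwise_def)
  have ne: "p \<noteq> []" "hd p \<in> set p" "hd p \<in> Q" if "p \<in> \<P>" for p
    using assms(1) that by (auto simp: disjoint_paths_def walk_def)
  have "inj_on hd \<P>"
    by (rule inj_onI) (metis disj ne(2) disjoint_iff)
  then have "hd ` \<P> = Q"
    using assms(2,3) ne(3) by (metis card_image card_subset_eq image_subsetI)
  then obtain p where p: "p \<in> \<P>" "hd p = s" using s by auto
  have "z = s" if z: "z \<in> set p" "z \<in> Q" for z
  proof -
    obtain q where "q \<in> \<P>" "hd q = z" using \<open>hd ` \<P> = Q\<close> z(2) by auto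
    then show ?thesis using disj[of p q] ne(2)[of q] p z(1) by (cases "p = q") auto
  qed
  then show ?thesis using that[of p] p ne s by blast
qed

text \<open>Goering's proof: delete an edge \<open>(x, y)\<close>; a separator \<open>S\<close> that becomes too small yields the two
  minimum separators \<open>S \<union> {x}\<close> and \<open>S \<union> {y}\<close>, and the path systems for them are glued along
  \<open>S\<close> and the deleted edge.\<close>

lemma glue_disjoint_paths:
  assumes S: "separates E' A T S" "finite S" "x \<notin> S" "y \<notin> S" and xy: "x \<noteq> y"
    and \<P>: "disjoint_paths E' A (insert x S) \<P>" "card \<P> = Suc (card S)"
    and \<Q>: "disjoint_paths E' (insert y S) T \<Q>" "card \<Q> = Suc (card S)"
  shows "\<exists>\<R>. disjoint_paths (insert (x, y) E') A T \<R> \<and> card \<R> = Suc (card S)"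
proof -
  let ?P = "insert x S" and ?Q = "insert y S" and ?E = "insert (x, y) E'"
  have "\<exists>p. p \<in> \<P> \<and> set p \<inter> ?P = {s} \<and> last p = s" if "s \<in> ?P" for s
    using disjoint_paths_onto[OF \<P>(1) _ _ that] S \<P>(2) by (metis card_insert_disjoint finite_insert)
  then obtain f where f: "f s \<in> \<P>" "set (f s) \<inter> ?P = {s}" "last (f s) = s" if "s \<in> ?P" for s
    by metis
  have "\<exists>p. p \<in> \<Q> \<and> set p \<inter> ?Q = {s} \<and> hd p = s" if "s \<in> ?Q" for s
    using disjoint_paths_onto_hd[OF \<Q>(1) _ _ that] S \<Q>(2) by (metis card_insert_disjoint finite_insert)
  then obtain g where g: "g s \<in> \<Q>" "set (g s) \<inter> ?Q = {s}" "hd (g s) = s" if "s \<in> ?Q" for s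
    by metis
  have fw: "walk E' A ?P (f s)" "distinct (f s)" if "s \<in> ?P" for s
    using \<P>(1) f(1)[OF that] by (auto simp: disjoint_paths_def)
  have gw: "walk E' ?Q T (g s)" "distinct (g s)" if "s \<in> ?Q" for s
    using \<Q>(1) g(1)[OF that] by (auto simp: disjoint_paths_def)
  have ff: "set (f s) \<inter> set (f t) = {}" if "s \<in> ?P" "t \<in> ?P" "s \<noteq> t" for s t
    using \<P>(1) f(1,3) that unfolding disjoint_paths_def pairwise_def by metis
  have gg: "set (g s) \<inter> set (g t) = {}" if "s \<in> ?Q" "t \<in> ?Q" "s \<noteq> t" for s t
    using \<Q>(1) g(1,3) that unfolding disjoint_paths_def pairwise_def by metis
  \<comment> \<open>If the paths met at \<open>z\<close> outside \<open>S\<close>, following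
    \<open>f s\<close> up to \<open>z\<close> and \<open>g t\<close> from there on would give a walk
    from \<open>A\<close> to \<open>T\<close> in \<open>E'\<close> that misses
    \<open>S\<close>.\<close>
  have fg: "z = s \<and> z = t" if st: "s \<in> ?P" "t \<in> ?Q" "z \<in> set (f s)" "z \<in> set (g t)" for s t z
  proof (cases "z \<in> S")
    case True
    then show ?thesis using f(2)[OF st(1)] g(2)[OF st(2)] st by blast
  next
    case False
    obtain p1 p2 where p: "f s = p1 @ z # p2" using st(3) by (meson split_list)
    obtain q1 q2 where q: "g t = q1 @ z # q2" using st(4) by (meson split_list)
    have "set p1 \<inter> S = {}"
    proof (rule ccontr)
      assume "set p1 \<inter> S \<noteq> {}"
      then have "s \<in> set p1" using f(2)[OF st(1)] p by auto
      moreover have "last (z # p2) = s" using f(3)[OF st(1)] p by simp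
      ultimately show False using fw(2)[OF st(1)] p
        by (metis disjoint_iff distinct_append last_in_set list.distinct(1))
    qed
    moreover have "set q2 \<inter> S = {}"
    proof (rule ccontr)
      assume "set q2 \<inter> S \<noteq> {}"
      then have "t \<in> set q2" using g(2)[OF st(2)] q by auto
      moreover have "hd (q1 @ [z]) = t" using g(3)[OF st(2)] q by (cases q1) auto
      then have "t \<in> set (q1 @ [z])" by (metis hd_in_set snoc_eq_iff_butlast)
      ultimately show False using gw(2)[OF st(2)] q by auto
    qed
    moreover have "walk E' A T ((p1 @ [z]) @ tl (z # q2))"
      using walk_append_tl[OF walk_prefix[OF fw(1)[OF st(1), unfolded p]]
          walk_suffix[OF gw(1)[OF st(2), unfolded q]]] by simp
    ultimately have False using S(1) False by (fastforce simp: separates_def)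
    then show ?thesis ..
  qed
  define h where "h s = (if s = x then f x @ g y else f s @ tl (g s))" for s
  have hS: "set (h s) \<subseteq> set (f s) \<union> set (g s)" if "s \<in> S" for s
    using that S by (cases "g s") (auto simp: h_def)
  have hset: "set (h s) \<subseteq> set (f s) \<union> set (g (if s = x then y else s))" if "s \<in> ?P" for s
    using that hS[of s] by (cases "s = x") (auto simp: h_def[of x])
  have hw: "walk ?E A T (h s) \<and> distinct (h s)" if s: "s \<in> ?P" for s
  proof (cases "s = x")
    case True
    have "set (f x) \<inter> set (g y) = {}" using fg[of x y] xy by blast
    moreover have "walk ?E A T (f x @ g y)"
      using walk_mono[OF fw(1)[of x] subset_insertI[of E' "(x, y)"]] walk_mono[OF gw(1)[of y] subset_insertI[of E' "(x, y)"]] f(3)[of x] g(3)[of y]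
      by (auto simp: walk_def successively_append_iff)
    ultimately show ?thesis using True fw(2)[of x] gw(2)[of y] by (auto simp: h_def)
  next
    case False
    then have sS: "s \<in> S" using s by auto
    have "walk ?E A T (f s @ tl (g s))"
      using walk_append_tl[OF walk_mono[OF fw(1)[OF s] subset_insertI] walk_mono[OF gw(1)[of s] subset_insertI]]
        f(3)[OF s] g(3)[of s] sS by auto
    moreover have "set (f s) \<inter> set (tl (g s)) = {}"
    proof -
      have "g s = s # tl (g s)" using gw(1)[of s] g(3)[of s] sS by (cases "g s") (auto simp: walk_def)
      then have "s \<notin> set (tl (g s))" using gw(2)[of s] sS by (metis distinct.simps(2) insertI2)
      then show ?thesis using fg[OF s, of s] sS by (metis \<open>g s = s # tl (g s)\<close> disjoint_iff insertI2 list.set_intros(2))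
    qed
    ultimately show ?thesis using False fw(2)[OF s] gw(2)[of s] sS by (auto simp: h_def distinct_tl)
  qed
  have hh: "set (h s) \<inter> set (h t) = {}" if st: "s \<in> ?P" "t \<in> ?P" "s \<noteq> t" for s t
  proof -
    let ?s = "if s = x then y else s" and ?t = "if t = x then y else t"
    have m: "?s \<in> ?Q" "?t \<in> ?Q" "?s \<noteq> ?t" using st S(4) by auto
    have "z \<notin> set (f s)" if "z \<in> set (g ?t)" for z
    proof
      assume "z \<in> set (f s)"
      then have "s = ?t" using fg[OF st(1) m(2) _ that] by blast
      then show False using st S(4) xy by (auto split: if_splits)
    qed
    moreover have "z \<notin> set (f t)" if "z \<in> set (g ?s)" for z
    proof
      assume "z \<in> set (f t)"
      then have "t = ?s" using fg[OF st(2) m(1) _ that] by blast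
      then show False using st S(4) xy by (auto split: if_splits)
    qed
    ultimately show ?thesis using hset[OF st(1)] hset[OF st(2)] ff[OF st] gg[OF m] by blast
  qed
  have "inj_on h ?P"
  proof (rule inj_onI)
    fix s t assume st: "s \<in> ?P" "t \<in> ?P" "h s = h t"
    have "h s \<noteq> []" using hw[OF st(1)] by (simp add: walk_def)
    then show "s = t" using hh[OF st(1,2)] st(3) by auto
  qed
  then have "card (h ` ?P) = Suc (card S)" using S by (simp add: card_image)
  moreover have "disjoint_paths ?E A T (h ` ?P)"
    unfolding disjoint_paths_def pairwise_def using S(2) hw hh by fast
  ultimately show ?thesis by blast
qed

lemma menger_aux:
  assumes "finite E" "finite A" "irrefl E"
    and "\<And>S. finite S \<Longrightarrow> separates E A T S \<Longrightarrow> k \<le> card S"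
  shows "\<exists>\<P>. disjoint_paths E A T \<P> \<and> card \<P> = k"
  using assms
proof (induction "card E" arbitrary: E A T k rule: less_induct)
  case less
  show ?case
  proof (cases "E = {}")
    case True
    have "separates E A T (A \<inter> T)"
      unfolding separates_def walk_def
    proof (intro allI impI)
      fix p assume "p \<noteq> [] \<and> hd p \<in> A \<and> last p \<in> T \<and> successively (\<lambda>u v. (u, v) \<in> E) p"
      then show "set p \<inter> (A \<inter> T) \<noteq> {}" using True
        by (cases p rule: remdups_adj.cases) auto
    qed
    then have "k \<le> card (A \<inter> T)" using less.prems by simp
    then obtain C where C: "C \<subseteq> A \<inter> T" "card C = k" "finite C"
      by (meson obtain_subset_with_card_n)
    have "disjoint_paths E A T ((\<lambda>a. [a]) ` C)"
      using C by (auto simp: disjoint_paths_def walk_def pairwise_def)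
    moreover have "card ((\<lambda>a. [a]) ` C) = k" using C by (simp add: card_image inj_on_def)
    ultimately show ?thesis by blast
  next
    case False
    then obtain x y where e: "(x, y) \<in> E" by auto
    let ?E = "E - {(x, y)}"
    have smaller: "card ?E < card E" and fin: "finite ?E"
      using card_Diff1_less[OF less.prems(1) e] less.prems(1) by auto
    have irr: "irrefl ?E" and xy: "x \<noteq> y" using e less.prems(3) by (auto simp: irrefl_def)
    show ?thesis
    proof (cases "\<forall>S. finite S \<longrightarrow> separates ?E A T S \<longrightarrow> k \<le> card S")
      case True
      then obtain \<P> where "disjoint_paths ?E A T \<P>" "card \<P> = k"
        using less.hyps[OF smaller fin less.prems(2) irr, of T k] by blast
      then have "disjoint_paths E A T \<P>"
        using walk_mono[of ?E A T _ E] by (auto simp: disjoint_paths_def)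
      then show ?thesis using \<open>card \<P> = k\<close> by blast
    next
      case False
      then obtain S where S: "finite S" "separates ?E A T S" "card S < k" by force
      \<comment> \<open>Any walk lost with the edge visits both of its ends, so adding either end to
        \<open>S\<close> restores separation.\<close>
      have split: "walk ?E A T p \<or> (x \<in> set p \<and> y \<in> set p)" if "walk E A T p" for p
      proof (rule disjCI)
        assume n: "\<not> (x \<in> set p \<and> y \<in> set p)"
        have "successively (\<lambda>u v. (u, v) \<in> ?E) p"
          by (rule successively_subset[of "\<lambda>u v. (u, v) \<in> E"]) (use that n in \<open>auto simp: walk_def\<close>)
        then show "walk ?E A T p" using that by (simp add: walk_def)
      qed
      have sx: "separates E A T (insert x S)" and sy: "separates E A T (insert y S)"
        using split S(2) unfolding separates_def by blast+
      have "k \<le> card (insert x S)" "k \<le> card (insert y S)"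
        using less.prems(4) sx sy S(1) by auto
      then have k: "x \<notin> S" "y \<notin> S" "k = Suc (card S)"
        using S(1,3) by (auto simp: card_insert_if split: if_splits)
      \<comment> \<open>A separator of \<open>A\<close> from \<open>insert x S\<close> in the
        smaller digraph also separates \<open>A\<close> from \<open>T\<close> in \<open>E\<close>,
        so the bound \<open>k\<close> is inherited and induction applies.\<close>
      obtain \<P> where \<P>: "disjoint_paths ?E A (insert x S) \<P>" "card \<P> = k"
        using less.hyps[OF smaller fin less.prems(2) irr, of "insert x S" k]
          separates_upto_first[OF sx] less.prems(4) by blast
      obtain \<Q> where \<Q>: "disjoint_paths ?E (insert y S) T \<Q>" "card \<Q> = k"
        using less.hyps[OF smaller fin _ irr, of "insert y S" T k] S(1)
          separates_from_last[OF sy] less.prems(4) by blast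
      have "insert (x, y) ?E = E" using e by auto
      then show ?thesis using glue_disjoint_paths[OF S(2,1) k(1,2) xy \<P>(1) _ \<Q>(1)] \<P>(2) \<Q>(2) k(3)
        by simp
    qed
  qed
qed

theorem menger:
  assumes "finite E" "finite A" "irrefl E"
  obtains \<P> S where "disjoint_paths E A T \<P>" "separates E A T S" "finite S" "card \<P> = card S"
proof -
  have "\<exists>S. finite S \<and> separates E A T S"
    using assms(2) by (intro exI[of _ A]) (auto simp: separates_def walk_def dest: hd_in_set)
  then obtain S where S: "finite S \<and> separates E A T S"
    "\<And>S'. finite S' \<and> separates E A T S' \<Longrightarrow> card S \<le> card S'"
    using ex_has_least_nat[of "\<lambda>S. finite S \<and> separates E A T S" _ card] by blast
  then show ?thesis using menger_aux[OF assms, of T "card S"] that by blast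
qed

section \<open>Blossoms in skew-symmetric digraphs\<close>

lemma opposite_opposite [simp]: "opposite (opposite t) = t"
  by (cases t) auto

lemma neq_iff_opposite: "t \<noteq> t' \<longleftrightarrow> t' = opposite t"
  by (cases t; cases t') auto

definition neg :: "'v \<times> sign \<Rightarrow> 'v \<times> sign" where
  "neg q = (fst q, opposite (snd q))"

lemma neg_simps [simp]: "fst (neg q) = fst q" "snd (neg q) = opposite (snd q)" "neg (neg q) = q"
  "neg (v, t) = (v, opposite t)"
  by (auto simp: neg_def)

lemma successively_rtranclp: "successively R p \<Longrightarrow> p \<noteq> [] \<Longrightarrow> R\<^sup>*\<^sup>* (hd p) (last p)"
proof (induction p rule: rev_induct)
  case (snoc y p)
  show ?case
  proof (cases "p = []")
    case False
    then have "R\<^sup>*\<^sup>* (hd p) (last p)" "R (last p) y"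
      using snoc by (simp_all add: successively_append_iff)
    then show ?thesis using False by (simp add: rtranclp.rtrancl_into_rtrancl)
  qed simp
qed simp

lemma rtranclp_distinct_list:
  assumes "R\<^sup>*\<^sup>* a c"
  shows "\<exists>p. p \<noteq> [] \<and> hd p = a \<and> last p = c \<and> distinct p \<and> successively R p"
  using assms
proof (induction rule: rtranclp_induct)
  case base
  show ?case by (rule exI[of _ "[a]"]) simp
next
  case (step y z)
  then obtain p where p: "p \<noteq> []" "hd p = a" "last p = y" "distinct p" "successively R p" by blast
  show ?case
  proof (cases "z \<in> set p")
    case True
    then obtain xs ys where "p = xs @ z # ys" by (meson split_list)
    then show ?thesis using p
      by (intro exI[of _ "xs @ [z]"]) (auto simp: successively_append_iff hd_append)
  next
    case False
    then show ?thesis using p step.hyps(2)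
      by (intro exI[of _ "p @ [z]"]) (auto simp: successively_append_iff)
  qed
qed

text \<open>A state \<open>(v, t)\<close> stands for having entered \<open>v\<close> through a half-edge of sign \<open>t\<close>. Reversing a
  traversal negates the states, which is the skew symmetry assumed below. The root is not a state;
  \<open>init\<close> holds of the states that can be entered from it.\<close>

locale skew_digraph =
  fixes V :: "'v set" and step :: "'v \<times> sign \<Rightarrow> 'v \<times> sign \<Rightarrow> bool" and init :: "'v \<times> sign \<Rightarrow> bool"
  assumes finite_V: "finite V"
    and step_V: "step p q \<Longrightarrow> fst q \<in> V"
    and init_V: "init q \<Longrightarrow> fst q \<in> V"
    and step_skew: "step p q \<Longrightarrow> step (neg q) (neg p)"
begin

text \<open>Vertices rather than states are distinct: a path must not pass through both states of a
  vertex. This is the difference from ordinary digraph paths that blossoms have to overcome.\<close>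

definition spath :: "('v \<times> sign) list \<Rightarrow> bool" where
  "spath P \<longleftrightarrow> P \<noteq> [] \<and> successively step P \<and> distinct (map fst P)"

lemma spath_append:
  assumes "spath P" "spath Q" "step (last P) (hd Q)" "fst ` set P \<inter> fst ` set Q = {}"
  shows "spath (P @ Q)"
  using assms by (auto simp: spath_def successively_append_iff)

lemma spath_rev:
  assumes "spath P"
  shows "spath (map neg (rev P))"
proof -
  have "successively (\<lambda>p q. step (neg q) (neg p)) P"
    using assms by (auto simp: spath_def elim: successively_mono intro: step_skew)
  moreover have "map fst (map neg (rev P)) = rev (map fst P)"
    by (simp add: rev_map comp_def)
  ultimately show ?thesis
    using assms by (simp add: spath_def successively_map successively_rev)
qed

lemma hd_last_reverse [simp]:
  "P \<noteq> [] \<Longrightarrow> hd (map neg (rev P)) = neg (last P)"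
  "P \<noteq> [] \<Longrightarrow> last (map neg (rev P)) = neg (hd P)"
  by (simp_all add: hd_map last_map hd_rev last_rev)

lemma join_reverse:
  assumes "spath P" "spath Q" "step (last P) (neg (last Q))" "fst ` set P \<inter> fst ` set Q = {}"
  shows "spath (P @ map neg (rev Q))" "hd (P @ map neg (rev Q)) = hd P"
    "last (P @ map neg (rev Q)) = neg (hd Q)"
    "fst ` set (P @ map neg (rev Q)) = fst ` set P \<union> fst ` set Q"
proof -
  have ne: "P \<noteq> []" "Q \<noteq> []" using assms by (auto simp: spath_def)
  have im: "fst ` set (map neg (rev Q)) = fst ` set Q" by (auto simp: image_image)
  show "spath (P @ map neg (rev Q))"
    by (rule spath_append[OF assms(1) spath_rev[OF assms(2)]]) (use assms(3,4) ne im in auto)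
  show "hd (P @ map neg (rev Q)) = hd P" using ne by simp
  show "last (P @ map neg (rev Q)) = neg (hd Q)" using ne by (simp add: last_map last_rev)
  show "fst ` set (P @ map neg (rev Q)) = fst ` set P \<union> fst ` set Q"
    using im by (simp add: image_Un)
qed

text \<open>With the root left out, this forbids leaving the root along \<open>P\<close> and
  returning from the last vertex of \<open>P\<close> by an edge whose sign there alternates with the
  arrival, that is, a nontrivial almost path from the root to itself.\<close>

definition clean_init :: bool where
  "clean_init \<longleftrightarrow> (\<forall>P. spath P \<longrightarrow> init (hd P) \<longrightarrow> \<not> init (neg (last P)))"

text \<open>These are the states known to be reachable from the root by a path: both states of a
  non-base, and of a base only the one in which its fibre is entered.\<close>

definition outer :: "'v set \<Rightarrow> ('v \<Rightarrow> 'v) \<Rightarrow> ('v \<Rightarrow> sign) \<Rightarrow> ('v \<times> sign) set" where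
  "outer W b s = {q. fst q \<in> W \<and> (b (fst q) \<noteq> fst q \<or> snd q = s (fst q))}"

definition arc :: "'v set \<Rightarrow> ('v \<Rightarrow> 'v) \<Rightarrow> ('v \<Rightarrow> sign) \<Rightarrow> 'v \<Rightarrow> 'v \<Rightarrow> bool" where
  "arc W b s c d \<longleftrightarrow> d \<in> W \<and> b d = d \<and> (\<exists>q\<in>outer W b s. b (fst q) = c \<and> step q (d, s d))"

end

text \<open>Edmonds' blossoms: \<open>W\<close> is partitioned into the fibres of \<open>b\<close>, each entered at its base \<open>c = b c\<close>
  with sign \<open>s c\<close>, from where every other state of the fibre is reached within the fibre.
  Contracting the fibres gives the digraph \<open>arc\<close> on the bases.\<close>

locale blossoms = skew_digraph V step init
  for V :: "'v set" and step init +
  fixes W :: "'v set" and b :: "'v \<Rightarrow> 'v" and s :: "'v \<Rightarrow> sign"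
  assumes W_V: "W \<subseteq> V"
    and b_W: "v \<in> W \<Longrightarrow> b v \<in> W"
    and b_b: "v \<in> W \<Longrightarrow> b (b v) = b v"
    and inner: "v \<in> W \<Longrightarrow> b v \<noteq> v \<Longrightarrow>
      \<exists>P. spath P \<and> hd P = (b v, s (b v)) \<and> last P = (v, t) \<and> fst ` set P \<subseteq> {w \<in> W. b w = b v}"
    and reach: "c \<in> W \<Longrightarrow> b c = c \<Longrightarrow>
      \<exists>a\<in>W. b a = a \<and> init (a, s a) \<and> (arc W b s)\<^sup>*\<^sup>* a c"
begin

section \<open>Lifting chains of bases to paths\<close>

lemma outer_inner:
  assumes "q \<in> outer W b s"
  shows "\<exists>P. spath P \<and> hd P = (b (fst q), s (b (fst q))) \<and> last P = q \<and>
    fst ` set P \<subseteq> {w \<in> W. b w = b (fst q)}"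
proof (cases "b (fst q) = fst q")
  case True
  then show ?thesis using assms
    by (intro exI[of _ "[q]"]) (auto simp: outer_def spath_def prod_eq_iff)
next
  case False
  then show ?thesis using assms inner[of "fst q" "snd q"] by (simp add: outer_def)
qed

text \<open>Replace each base by a path within its fibre to the state from which the next arc
  departs. Distinct bases have disjoint fibres, so no vertex repeats.\<close>

lemma lift:
  assumes "successively (arc W b s) cs" "cs \<noteq> []" "distinct cs" "hd cs \<in> W" "b (hd cs) = hd cs"
    and "q \<in> outer W b s" "b (fst q) = last cs"
  shows "\<exists>P. spath P \<and> hd P = (hd cs, s (hd cs)) \<and> last P = q \<and> fst ` set P \<subseteq> {w \<in> W. b w \<in> set cs}"
  using assms
proof (induction cs arbitrary: q rule: rev_induct)
  case (snoc c cs)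
  obtain Q where Q: "spath Q" "hd Q = (c, s c)" "last Q = q" "fst ` set Q \<subseteq> {w \<in> W. b w = c}"
    using outer_inner[OF snoc.prems(6)] snoc.prems(7) by auto
  show ?case
  proof (cases "cs = []")
    case True
    then show ?thesis using Q by auto
  next
    case False
    then have "arc W b s (last cs) c" using snoc.prems(1) by (simp add: successively_append_iff)
    then obtain p where p: "p \<in> outer W b s" "b (fst p) = last cs" "step p (c, s c)"
      by (auto simp: arc_def)
    obtain P where P: "spath P" "hd P = (hd cs, s (hd cs))" "last P = p"
      "fst ` set P \<subseteq> {w \<in> W. b w \<in> set cs}"
      using snoc.IH[OF _ False _ _ _ p(1,2)] snoc.prems False by (auto simp: successively_append_iff)
    have "fst ` set P \<inter> fst ` set Q = {}" using P(4) Q(4) snoc.prems(3) by auto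
    then have "spath (P @ Q)" using spath_append[OF P(1) Q(1)] P(3) Q(2) p(3) by simp
    moreover have "P \<noteq> []" "Q \<noteq> []" using P(1) Q(1) by (auto simp: spath_def)
    ultimately show ?thesis using P Q False by (intro exI[of _ "P @ Q"]) auto
  qed
qed simp

lemma reach_list:
  assumes "c \<in> W" "b c = c"
  shows "\<exists>cs. cs \<noteq> [] \<and> hd cs \<in> W \<and> b (hd cs) = hd cs \<and> init (hd cs, s (hd cs)) \<and> last cs = c \<and>
    distinct cs \<and> successively (arc W b s) cs"
proof -
  obtain a where a: "a \<in> W" "b a = a" "init (a, s a)" "(arc W b s)\<^sup>*\<^sup>* a c" using reach[OF assms] by blast
  then show ?thesis using rtranclp_distinct_list[OF a(4)] by metis
qed

lemma chain_bases:
  assumes "successively (arc W b s) cs" "cs \<noteq> []" "hd cs \<in> W" "b (hd cs) = hd cs" "c \<in> set cs"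
  shows "c \<in> W" "b c = c"
proof -
  have "\<forall>c\<in>set cs. c \<in> W \<and> b c = c" using assms(1-4)
  proof (induction cs rule: rev_induct)
    case (snoc c cs)
    show ?case
    proof (cases "cs = []")
      case True
      then show ?thesis using snoc.prems by simp
    next
      case False
      then have *: "successively (arc W b s) cs" "arc W b s (last cs) c" "hd cs \<in> W" "b (hd cs) = hd cs"
        using snoc.prems by (simp_all add: successively_append_iff)
      have "c \<in> W \<and> b c = c" using *(2) unfolding arc_def by blast
      then show ?thesis using snoc.IH[OF *(1) False *(3,4)] by simp
    qed
  qed simp
  then show "c \<in> W" "b c = c" using assms(5) by auto
qed

lemma lift_from_init:
  assumes "q \<in> outer W b s"
  shows "\<exists>P. spath P \<and> init (hd P) \<and> last P = q"
proof -
  have "fst q \<in> W" using assms by (simp add: outer_def)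
  then obtain cs where cs: "cs \<noteq> []" "hd cs \<in> W" "b (hd cs) = hd cs" "init (hd cs, s (hd cs))"
    "last cs = b (fst q)" "distinct cs" "successively (arc W b s) cs"
    using reach_list b_W b_b by metis
  then show ?thesis using lift[OF cs(7,1,6,2,3) assms] by metis
qed

section \<open>Enlarging a family of blossoms\<close>

lemma add_vertex:
  assumes "w \<notin> W" "init (w, t) \<or> (\<exists>p\<in>outer W b s. step p (w, t))"
  shows "blossoms V step init (insert w W) (b(w := w)) (s(w := t))"
proof -
  \<comment> \<open>The new vertex is a fibre of its own, so it is claimed to be reachable in the
    state \<open>(w, t)\<close> only and no inner path is owed.\<close>
  let ?W = "insert w W" and ?b = "b(w := w)" and ?s = "s(w := t)"
  have w: "w \<in> V" using assms(2) step_V init_V by fastforce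
  have outer: "outer W b s \<subseteq> outer ?W ?b ?s" using assms(1) b_W by (auto simp: outer_def)
  have arc: "arc ?W ?b ?s c d" if "arc W b s c d" for c d
    using that outer assms(1) unfolding arc_def by (fastforce simp: outer_def)
  have star: "(arc ?W ?b ?s)\<^sup>*\<^sup>* c d" if "(arc W b s)\<^sup>*\<^sup>* c d" for c d
    using that by (rule rtranclp_mono[THEN predicate2D, rotated]) (use arc in auto)
  have old: "\<exists>a\<in>?W. ?b a = a \<and> init (a, ?s a) \<and> (arc ?W ?b ?s)\<^sup>*\<^sup>* a c" if c: "c \<in> W" "b c = c" for c
  proof -
    obtain a where a: "a \<in> W" "b a = a" "init (a, s a)" "(arc W b s)\<^sup>*\<^sup>* a c" using reach[OF c] by blast
    then show ?thesis using star[OF a(4)] assms(1) by (intro bexI[of _ a]) auto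
  qed
  show ?thesis
  proof
    show "?W \<subseteq> V" using W_V w by simp
    show "?b v \<in> ?W" if "v \<in> ?W" for v using that b_W by auto
    show "?b (?b v) = ?b v" if "v \<in> ?W" for v using that b_W b_b by auto
    show "\<exists>P. spath P \<and> hd P = (?b v, ?s (?b v)) \<and> last P = (v, t') \<and> fst ` set P \<subseteq> {x \<in> ?W. ?b x = ?b v}"
      if v: "v \<in> ?W" "?b v \<noteq> v" for v t'
    proof -
      have vW: "v \<in> W" "b v \<noteq> v" using v by (auto split: if_splits)
      then obtain P where P: "spath P" "hd P = (b v, s (b v))" "last P = (v, t')"
        "fst ` set P \<subseteq> {x \<in> W. b x = b v}" using inner by blast
      have "b v \<noteq> w" "v \<noteq> w" using vW b_W assms(1) by auto
      then show ?thesis using P assms(1) by (intro exI[of _ P]) auto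
    qed
    show "\<exists>a\<in>?W. ?b a = a \<and> init (a, ?s a) \<and> (arc ?W ?b ?s)\<^sup>*\<^sup>* a c" if c: "c \<in> ?W" "?b c = c" for c
    proof (cases "c = w")
      case True
      show ?thesis using assms(2)
      proof
        assume "init (w, t)"
        then show ?thesis using True by (intro bexI[of _ w]) auto
      next
        assume "\<exists>p\<in>outer W b s. step p (w, t)"
        then obtain p where p: "p \<in> outer W b s" "step p (w, t)" by blast
        have pW: "fst p \<in> W" using p(1) by (simp add: outer_def)
        have "p \<in> outer ?W ?b ?s" "?b (fst p) = b (fst p)" using p(1) pW outer assms(1) by auto
        then have "arc ?W ?b ?s (b (fst p)) w" using p(2) unfolding arc_def
          by (auto intro!: bexI[of _ p])
        moreover obtain a where "a \<in> ?W" "?b a = a" "init (a, ?s a)" "(arc ?W ?b ?s)\<^sup>*\<^sup>* a (b (fst p))"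
          using old[OF b_W[OF pW] b_b[OF pW]] by blast
        ultimately show ?thesis using True by (meson rtranclp.rtrancl_into_rtrancl)
      qed
    next
      case False
      then show ?thesis using old c by auto
    qed
  qed
qed

text \<open>The two chains from \<open>z\<close> and the step between \<open>u\<close> and
  \<open>w\<close> form a cycle. A vertex on the first chain is reached in one state along that
  chain and in the other by going round the cycle, which is what makes the cycle a blossom with base
  \<open>z\<close>. Applying this twice covers both chains.\<close>

lemma around_half:
  assumes c: "successively (arc W b s) (z # cs)" "distinct (z # cs)"
    and d: "successively (arc W b s) (z # ds)" "distinct (z # ds)"
    and z: "z \<in> W" "b z = z" and disj: "set cs \<inter> set ds = {}"
    and u: "u \<in> outer W b s" "b (fst u) = last (z # cs)"
    and w: "w \<in> outer W b s" "b (fst w) = last (z # ds)"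
    and uw: "step u (neg w)"
    and v: "v \<in> W" "b v \<in> set (z # cs)" "v \<noteq> z"
  shows "\<exists>P. spath P \<and> hd P = (z, s z) \<and> last P = (v, t) \<and>
    fst ` set P \<subseteq> {x \<in> W. b x \<in> set (z # cs @ ds)}"
proof -
  obtain xs ys where xy: "z # cs = xs @ b v # ys" using v(2) by (meson split_list)
  have hd: "hd (xs @ [b v]) = z" using xy by (cases xs) auto
  show ?thesis
  proof (cases "(v, t) \<in> outer W b s")
    case True
    have "\<exists>P. spath P \<and> hd P = (hd (xs @ [b v]), s (hd (xs @ [b v]))) \<and> last P = (v, t) \<and>
      fst ` set P \<subseteq> {w \<in> W. b w \<in> set (xs @ [b v])}"
    proof (rule lift[OF _ _ _ _ _ True])
      show "successively (arc W b s) (xs @ [b v])" using c(1) unfolding xy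
        by (auto simp: successively_append_iff)
      show "distinct (xs @ [b v])" using c(2) unfolding xy by auto
    qed (use hd z in auto)
    moreover have "set (xs @ [b v]) \<subseteq> set (z # cs)" unfolding xy by auto
    ultimately show ?thesis unfolding hd by fastforce
  next
    case False
    \<comment> \<open>The only state not yet available is that of a base taken against its entry
      sign.\<close>
    then have bv: "b v = v" "t = opposite (s v)" using v(1) by (auto simp: outer_def neq_iff_opposite)
    have xs: "xs \<noteq> []" using hd bv v(3) by auto
    then have ys: "set (v # ys) \<subseteq> set cs" "z \<notin> set (v # ys)" using xy bv c(2)
      by (cases xs; auto)+
    \<comment> \<open>The way round: along \<open>ds\<close> to \<open>w\<close>, across to
      \<open>u\<close>, then backwards through \<open>Q\<close> to \<open>v\<close>, arriving
      against its entry sign.\<close>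
    obtain P where P: "spath P" "hd P = (z, s z)" "last P = w"
      "fst ` set P \<subseteq> {x \<in> W. b x \<in> set (z # ds)}"
      using lift[OF d(1) _ d(2) _ _ w] z by auto
    have "\<exists>P. spath P \<and> hd P = (hd (v # ys), s (hd (v # ys))) \<and> last P = u \<and>
      fst ` set P \<subseteq> {w \<in> W. b w \<in> set (v # ys)}"
    proof (rule lift[OF _ _ _ _ _ u(1)])
      show "successively (arc W b s) (v # ys)" using c(1) unfolding xy bv
        by (auto simp: successively_append_iff)
      show "distinct (v # ys)" using c(2) unfolding xy bv by auto
      show "b (fst u) = last (v # ys)" using u(2) unfolding xy bv by simp
    qed (use v bv in auto)
    then obtain Q where Q: "spath Q" "hd Q = (v, s v)" "last Q = u"
      "fst ` set Q \<subseteq> {x \<in> W. b x \<in> set (v # ys)}" by auto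
    have "set (z # ds) \<inter> set (v # ys) = {}" using ys disj by auto
    then have dPQ: "fst ` set P \<inter> fst ` set Q = {}" using P(4) Q(4) by blast
    have "step (last P) (neg (last Q))" using step_skew[OF uw] P(3) Q(3) by simp
    note j = join_reverse[OF P(1) Q(1) this dPQ]
    show ?thesis
    proof (intro exI conjI)
      show "spath (P @ map neg (rev Q))" by (rule j(1))
      show "hd (P @ map neg (rev Q)) = (z, s z)" using j(2) P(2) by simp
      show "last (P @ map neg (rev Q)) = (v, t)" using j(3) Q(2) bv by simp
      show "fst ` set (P @ map neg (rev Q)) \<subseteq> {x \<in> W. b x \<in> set (z # cs @ ds)}"
        unfolding j(4) using P(4) Q(4) ys(1) by auto
    qed
  qed
qed

text \<open>Chains of bases lead to the fibres of \<open>u\<close> and of \<open>w\<close>, and the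
  step between these closes a cycle. It is shrunk into one fibre whose base is the last vertex of
  the second chain that lies on the first.\<close>

lemma merge:
  assumes clean: clean_init
    and u: "u \<in> outer W b s" and w: "w \<in> outer W b s"
    and uw: "step u (neg w)" and ne: "b (fst u) \<noteq> b (fst w)"
  shows "\<exists>b'. blossoms V step init W b' s \<and> {v \<in> W. b v \<noteq> v} \<subset> {v \<in> W. b' v \<noteq> v}"
proof -
  have uW: "fst u \<in> W" "fst w \<in> W" using u w by (auto simp: outer_def)
  obtain cs where cs: "cs \<noteq> []" "hd cs \<in> W" "b (hd cs) = hd cs" "init (hd cs, s (hd cs))"
    "last cs = b (fst u)" "distinct cs" "successively (arc W b s) cs"
    using reach_list uW b_W b_b by metis
  obtain ds where ds: "ds \<noteq> []" "hd ds \<in> W" "b (hd ds) = hd ds" "init (hd ds, s (hd ds))"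
    "last ds = b (fst w)" "distinct ds" "successively (arc W b s) ds"
    using reach_list uW b_W b_b by metis
  \<comment> \<open>Disjoint chains would lift to disjoint paths from the root; joined by the step
    between \<open>u\<close> and \<open>w\<close> they lead back to the root, against
    cleanness.\<close>
  have meet: "set cs \<inter> set ds \<noteq> {}"
  proof
    assume disj: "set cs \<inter> set ds = {}"
    obtain P where P: "spath P" "hd P = (hd cs, s (hd cs))" "last P = u"
      "fst ` set P \<subseteq> {x \<in> W. b x \<in> set cs}"
      using lift[OF cs(7,1,6,2,3) u cs(5)[symmetric]] by blast
    obtain Q where Q: "spath Q" "hd Q = (hd ds, s (hd ds))" "last Q = w"
      "fst ` set Q \<subseteq> {x \<in> W. b x \<in> set ds}"
      using lift[OF ds(7,1,6,2,3) w ds(5)[symmetric]] by blast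
    have "fst ` set P \<inter> fst ` set Q = {}" using P(4) Q(4) disj by blast
    note j = join_reverse[OF P(1) Q(1) _ this]
    have st: "step (last P) (neg (last Q))" using uw P(3) Q(3) by simp
    show False using j[OF st] clean cs(4) ds(4) P(2) Q(2) unfolding clean_init_def
      by (metis neg_simps(3))
  qed
  then have "\<exists>x\<in>set ds. x \<in> set cs" by auto
  then obtain d1 z d2 where d: "ds = d1 @ z # d2" "z \<in> set cs" "\<forall>x\<in>set d2. x \<notin> set cs"
    using split_list_last_prop[of ds "\<lambda>x. x \<in> set cs"] by blast
  obtain c1 c2 where c: "cs = c1 @ z # c2" using d(2) by (meson split_list)
  note cbase = chain_bases[OF cs(7,1,2,3)] and dbase = chain_bases[OF ds(7,1,2,3)]
  have z: "z \<in> W" "b z = z" using cbase d(2) by auto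
  define M where "M = set (z # c2 @ d2)"
  have Mbase: "x \<in> W" "b x = x" if "x \<in> M" for x
    using that cbase dbase c d(1) by (auto simp: M_def)
  define b' where "b' v = (if b v \<in> M then z else b v)" for v
  have zM: "z \<in> M" by (simp add: M_def)
  have b'z: "b' z = z" using z zM by (simp add: b'_def)
  have b'W: "b' v \<in> W" if "v \<in> W" for v using that b_W z by (simp add: b'_def)
  have outer: "outer W b s \<subseteq> outer W b' s" using z by (auto simp: outer_def b'_def)
  have c2: "successively (arc W b s) (z # c2)" "distinct (z # c2)" "b (fst u) = last (z # c2)"
    using cs(5-7) c by (auto simp: successively_append_iff)
  have d2: "successively (arc W b s) (z # d2)" "distinct (z # d2)" "b (fst w) = last (z # d2)"
    using ds(5-7) d(1) by (auto simp: successively_append_iff)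
  have cd: "set c2 \<inter> set d2 = {}" using d(3) c by auto
  have arc': "arc W b' s (b' c) d" if cd: "arc W b s c d" "b' d = d" "b c = c" for c d
  proof -
    obtain q where q: "d \<in> W" "q \<in> outer W b s" "b (fst q) = c" "step q (d, s d)"
      using cd(1) unfolding arc_def by blast
    have "b' (fst q) = b' c" using q(3) cd(3) by (simp add: b'_def)
    then show ?thesis using q cd(2) outer unfolding arc_def by blast
  qed
  have "blossoms V step init W b' s"
  proof
    show "W \<subseteq> V" by (rule W_V)
    show "b' v \<in> W" if "v \<in> W" for v by (rule b'W[OF that])
    show "b' (b' v) = b' v" if "v \<in> W" for v using b'z b_b[OF that] by (simp add: b'_def)
    show "\<exists>P. spath P \<and> hd P = (b' v, s (b' v)) \<and> last P = (v, t) \<and> fst ` set P \<subseteq> {x \<in> W. b' x = b' v}"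
      if v: "v \<in> W" "b' v \<noteq> v" for v t
    proof (cases "b v \<in> M")
      case False
      then have "b' v = b v" "b v \<noteq> v" using v(2) by (auto simp: b'_def)
      moreover obtain P where "spath P" "hd P = (b v, s (b v))" "last P = (v, t)"
        "fst ` set P \<subseteq> {x \<in> W. b x = b v}" using inner[OF v(1) \<open>b v \<noteq> v\<close>] by blast
      ultimately show ?thesis using False by (intro exI[of _ P]) (auto simp: b'_def)
    next
      case True
      then have bv: "b' v = z" "v \<noteq> z" using v(2) by (auto simp: b'_def)
      have "\<exists>P. spath P \<and> hd P = (z, s z) \<and> last P = (v, t) \<and> fst ` set P \<subseteq> {x \<in> W. b x \<in> M}"
      proof (cases "b v \<in> set (z # c2)")
        case True
        then show ?thesis
          using around_half[OF c2(1,2) d2(1,2) z cd u c2(3) w d2(3) uw v(1) _ bv(2)] by (auto simp: M_def)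
      next
        case False
        then have "b v \<in> set (z # d2)" using \<open>b v \<in> M\<close> by (auto simp: M_def)
        moreover have "step w (neg u)" using step_skew[OF uw] by simp
        ultimately have "\<exists>P. spath P \<and> hd P = (z, s z) \<and> last P = (v, t) \<and>
            fst ` set P \<subseteq> {x \<in> W. b x \<in> set (z # d2 @ c2)}"
          using around_half[OF d2(1,2) c2(1,2) z _ w d2(3) u c2(3) _ v(1) _ bv(2)] cd by (auto simp: Int_commute)
        moreover have "set (z # d2 @ c2) = M" by (auto simp: M_def)
        ultimately show ?thesis by (simp only:)
      qed
      then show ?thesis using bv by (auto simp: b'_def)
    qed
    have hdz: "hd (c1 @ [z]) = hd cs" by (simp add: c hd_append)
    have notM: "x \<notin> M" if "x \<in> set c1" for x
      using that cs(6) d(3) c by (auto simp: M_def)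
    have "successively (arc W b s) (c1 @ [z])" using cs(7) c by (auto simp: successively_append_iff)
    then have "successively (arc W b' s) (c1 @ [z])"
    proof (rule successively_subset)
      fix xs x y ys assume eq: "c1 @ [z] = xs @ x # y # ys" and xy: "arc W b s x y"
      have "butlast (c1 @ [z]) = xs @ x # butlast (y # ys)" unfolding eq by (simp add: butlast_append)
      then have x: "x \<in> set c1" by simp
      have "y \<in> set (c1 @ [z])" unfolding eq by simp
      then have "b' y = y" using notM b'z cbase(2)[of y] c by (auto simp: b'_def)
      moreover have "b x = x" using cbase(2)[of x] x c by simp
      ultimately show "arc W b' s x y" using arc'[OF xy] notM[OF x] by (simp add: b'_def)
    qed
    then have "(arc W b' s)\<^sup>*\<^sup>* (hd cs) z" using successively_rtranclp[of _ "c1 @ [z]"] hdz by auto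
    moreover have "b' (hd cs) = hd cs"
      using hdz notM b'z cs(3) by (cases c1) (auto simp: b'_def)
    ultimately have toz: "\<exists>a\<in>W. b' a = a \<and> init (a, s a) \<and> (arc W b' s)\<^sup>*\<^sup>* a z"
      using cs(2,4) by blast
    \<comment> \<open>Whenever the old chain runs into \<open>M\<close>, it is replaced by the chain
      to \<open>z\<close>; an arc that leaves \<open>M\<close> becomes an arc that leaves
      \<open>z\<close>.\<close>
    have reach': "\<exists>a\<in>W. b' a = a \<and> init (a, s a) \<and> (arc W b' s)\<^sup>*\<^sup>* a (b' c)"
      if "(arc W b s)\<^sup>*\<^sup>* a c" "a \<in> W" "b a = a" "init (a, s a)" for a c
      using that
    proof (induction rule: rtranclp_induct)
      case base
      have "b' a = (if a \<in> M then z else a)" using base(2) by (simp add: b'_def)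
      then show ?case using toz base by (cases "a \<in> M") auto
    next
      case (step x y)
      have y: "b y = y" using step.hyps(2) by (auto simp: arc_def)
      have x: "b x = x"
        using step.hyps(1) step.prems(2) by (cases rule: rtranclp.cases) (auto simp: arc_def)
      show ?case
      proof (cases "y \<in> M")
        case True
        then have "b' y = z" using y by (simp add: b'_def)
        then show ?thesis using toz by simp
      next
        case False
        then have "b' y = y" using y by (simp add: b'_def)
        then show ?thesis using step.IH[OF step.prems] arc'[OF step.hyps(2) _ x]
          by (metis rtranclp.rtrancl_into_rtrancl)
      qed
    qed
    show "\<exists>a\<in>W. b' a = a \<and> init (a, s a) \<and> (arc W b' s)\<^sup>*\<^sup>* a c" if c: "c \<in> W" "b' c = c" for c
    proof -
      have "b c = c" using c z by (auto simp: b'_def split: if_splits)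
      then obtain a where "a \<in> W" "b a = a" "init (a, s a)" "(arc W b s)\<^sup>*\<^sup>* a c"
        using reach[OF c(1)] by blast
      then show ?thesis using reach' c(2) by metis
    qed
  qed
  moreover have "{v \<in> W. b v \<noteq> v} \<subset> {v \<in> W. b' v \<noteq> v}"
  proof -
    have sub: "{v \<in> W. b v \<noteq> v} \<subseteq> {v \<in> W. b' v \<noteq> v}" using z by (auto simp: b'_def)
    have "b (fst u) \<in> M" "b (fst w) \<in> M" using c2(3) d2(3) by (auto simp: M_def)
    \<comment> \<open>The two bases differ, so at least one of them is not \<open>z\<close> and
      stops being a base.\<close>
    then obtain y where y: "y \<in> M" "y \<noteq> z" using ne by metis
    then have "y \<in> {v \<in> W. b' v \<noteq> v} - {v \<in> W. b v \<noteq> v}" using Mbase by (auto simp: b'_def)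
    then show ?thesis using sub by blast
  qed
  ultimately show ?thesis by blast
qed

end

section \<open>Maximal families of blossoms\<close>

locale closed_blossoms = blossoms +
  assumes init_closed: "init q \<Longrightarrow> fst q \<in> W \<and> b (fst q) = fst q \<and> snd q = s (fst q)"
    and step_closed: "p \<in> outer W b s \<Longrightarrow> step p q \<Longrightarrow>
      fst q \<in> W \<and> (b (fst q) = b (fst p) \<or> b (fst q) = fst q \<and> snd q = s (fst q))"
begin

text \<open>A fibre is entered at its base, so the base is already used up while the path moves
  inside the fibre. Hence the path cannot come back to the base against its entry sign, the one way
  in which a closed step could leave the outer states.\<close>

lemma spath_respects:
  assumes "spath P" "init (hd P)"
  shows "set P \<subseteq> outer W b s" "b ` fst ` set P \<subseteq> fst ` set P"
proof -
  have "set P \<subseteq> outer W b s \<and> b ` fst ` set P \<subseteq> fst ` set P" using assms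
  proof (induction P rule: rev_induct)
    case Nil
    then show ?case by (simp add: spath_def)
  next
    case (snoc q P)
    show ?case
    proof (cases "P = []")
      case True
      then show ?thesis using snoc.prems(2) init_closed by (auto simp: outer_def)
    next
      case False
      have *: "spath P" "step (last P) q" "fst q \<notin> fst ` set P"
        using snoc.prems(1) False by (auto simp: spath_def successively_append_iff)
      then have IH: "set P \<subseteq> outer W b s" "b ` fst ` set P \<subseteq> fst ` set P"
        using snoc.IH snoc.prems(2) False by auto
      have "last P \<in> outer W b s" using IH(1) False by auto
      note cl = step_closed[OF this *(2)]
      define F where "F = fst ` set P"
      have "b (fst (last P)) \<in> F" using IH(2) False by (auto simp: F_def)
      then have "q \<in> outer W b s" "b (fst q) \<in> insert (fst q) F"
        using cl *(3)[folded F_def] by (auto simp: outer_def)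
      then have "q \<in> outer W b s" "b (fst q) \<in> fst ` set (P @ [q])" by (auto simp: F_def)
      then show ?thesis using IH by auto
    qed
  qed
  then show "set P \<subseteq> outer W b s" "b ` fst ` set P \<subseteq> fst ` set P" by auto
qed

end

context skew_digraph begin

text \<open>A family of maximal size admits neither an added vertex nor a merge, and a violation of
  closedness would allow one of these or contradict cleanness.\<close>

lemma closed_blossoms_exist:
  assumes clean_init
  shows "\<exists>W b s. closed_blossoms V step init W b s"
proof -
  \<comment> \<open>Adding a vertex raises the first summand and keeps the second; merging raises
    the second and keeps the first. Each is at most \<open>card V\<close>.\<close>
  define size where "size = (\<lambda>(W, b, s :: 'v \<Rightarrow> sign). card W + card {v \<in> W. b v \<noteq> (v :: 'v)})"
  let ?ok = "\<lambda>(W, b, s). blossoms V step init W b s"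
  have "blossoms V step init {} id (\<lambda>_. Plus)" by unfold_locales auto
  then have "?ok ({}, id, \<lambda>_. Plus)" by simp
  moreover have "size X < Suc (card V + card V)" if "?ok X" for X
  proof -
    obtain W b s where X: "X = (W, b, s)" by (cases X)
    then have "W \<subseteq> V" using that by (simp add: blossoms.W_V)
    then have "card W \<le> card V" "card {v \<in> W. b v \<noteq> v} \<le> card V"
      using finite_V by (auto intro!: card_mono)
    then show ?thesis by (simp add: size_def X)
  qed
  ultimately obtain X where X: "?ok X" "\<And>Y. ?ok Y \<Longrightarrow> size Y \<le> size X"
    using ex_has_greatest_nat[of ?ok _ size "Suc (card V + card V)"] by (metis (no_types, lifting) less_imp_le)
  obtain W b s where Xe: "X = (W, b, s)" by (cases X)
  interpret blossoms V step init W b s using X(1) Xe by simp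
  have finW: "finite W" using W_V finite_V finite_subset by blast
  have max: "card W' + card {v \<in> W'. b' v \<noteq> v} \<le> card W + card {v \<in> W. b v \<noteq> v}"
    if "blossoms V step init W' b' s'" for W' b' s'
    using X(2)[of "(W', b', s')"] that by (simp add: size_def Xe)
  have noadd: "w \<in> W" if "init (w, t) \<or> (\<exists>p\<in>outer W b s. step p (w, t))" for w t
  proof (rule ccontr)
    assume "w \<notin> W"
    moreover have "{v \<in> W. b v \<noteq> v} = {v \<in> insert w W. (b(w := w)) v \<noteq> v}" using \<open>w \<notin> W\<close> by auto
    ultimately show False using max[OF add_vertex[OF _ that]] finW by simp
  qed
  have nomerge: "b (fst u) = b (fst w)"
    if uw: "u \<in> outer W b s" "w \<in> outer W b s" "step u (neg w)" for u w
  proof (rule ccontr)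
    assume "b (fst u) \<noteq> b (fst w)"
    then obtain b' where b': "blossoms V step init W b' s" "{v \<in> W. b v \<noteq> v} \<subset> {v \<in> W. b' v \<noteq> v}"
      using merge[OF assms uw] by blast
    have "card {v \<in> W. b v \<noteq> v} < card {v \<in> W. b' v \<noteq> v}"
      using b'(2) finW by (intro psubset_card_mono) auto
    then show False using max[OF b'(1)] by simp
  qed
  have negouter: "neg q \<in> outer W b s" if "fst q \<in> W" "\<not> (b (fst q) = fst q \<and> snd q = s (fst q))" for q
    using that neq_iff_opposite[of "snd q" "s (fst q)"] by (auto simp: outer_def)
  have "closed_blossoms V step init W b s"
  proof
    fix q assume q: "init q"
    have "fst q \<in> W" using noadd[of "fst q" "snd q"] q by simp
    moreover have "b (fst q) = fst q \<and> snd q = s (fst q)"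
    proof (rule ccontr)
      assume "\<not> ?thesis"
      \<comment> \<open>If \<open>q\<close> is not an entry state, then \<open>neg q\<close> is
        outer, so a path from the root ends in it and could return to the root through
        \<open>q\<close> reversed.\<close>
      then obtain P where P: "spath P" "init (hd P)" "last P = neg q"
        using lift_from_init negouter \<open>fst q \<in> W\<close> by blast
      then show False using assms q unfolding clean_init_def by (metis neg_simps(3))
    qed
    ultimately show "fst q \<in> W \<and> b (fst q) = fst q \<and> snd q = s (fst q)" by simp
  next
    fix p q assume p: "p \<in> outer W b s" and pq: "step p q"
    have "fst q \<in> W" using noadd[of "fst q" "snd q"] p pq by auto
    moreover have "b (fst q) = b (fst p)" if "\<not> (b (fst q) = fst q \<and> snd q = s (fst q))"
      using nomerge[OF p negouter[OF \<open>fst q \<in> W\<close> that]] pq by simp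
    ultimately show "fst q \<in> W \<and> (b (fst q) = b (fst p) \<or> b (fst q) = fst q \<and> snd q = s (fst q))"
      by blast
  qed
  then show ?thesis by blast
qed

end

section \<open>Bidirected graphs as skew-symmetric digraphs\<close>

text \<open>Sign alternation is turned into composability of steps. The edge itself is forgotten, so
  parallel edges with equal signs yield the same step; leaving out \<open>r\<close> loses no paths,
  as a path from \<open>r\<close> never returns to it.\<close>

definition bstep :: "('v, 'e) bidirected \<Rightarrow> 'v \<Rightarrow> 'v \<times> sign \<Rightarrow> 'v \<times> sign \<Rightarrow> bool" where
  "bstep B r p q \<longleftrightarrow> fst p \<noteq> r \<and> fst q \<noteq> r \<and>
     (\<exists>e\<in>edges B. endpoints B e = {fst p, fst q} \<and>
        sign_of B e (fst p) = opposite (snd p) \<and> sign_of B e (fst q) = snd q)"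

definition binit :: "('v, 'e) bidirected \<Rightarrow> 'v \<Rightarrow> 'v \<times> sign \<Rightarrow> bool" where
  "binit B r q \<longleftrightarrow> fst q \<noteq> r \<and>
     (\<exists>e\<in>edges B. endpoints B e = {r, fst q} \<and> sign_of B e (fst q) = snd q)"

definition arrivals :: "('v, 'e) bidirected \<Rightarrow> ('v, 'e) oedge list \<Rightarrow> ('v \<times> sign) list" where
  "arrivals B fs = map (\<lambda>f. (head f, sign_of B (edge f) (head f))) fs"

lemma trail_nth:
  assumes "trail B (vs, fs)"
  shows "length vs = Suc (length fs)" "set vs \<subseteq> verts B" "distinct (map edge fs)"
    "\<And>i. i < length fs \<Longrightarrow> oriented_edge B (fs ! i)"
    "\<And>i. i < length fs \<Longrightarrow> tail (fs ! i) = vs ! i"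
    "\<And>i. i < length fs \<Longrightarrow> head (fs ! i) = vs ! Suc i"
    "\<And>i. Suc i < length fs \<Longrightarrow> sign_of B (edge (fs ! Suc i)) (vs ! Suc i) =
      opposite (sign_of B (edge (fs ! i)) (vs ! Suc i))"
  using assms by (auto simp: trail_def)

text \<open>States do not record edges. On a path the endpoints of an edge determine its position,
  so edges chosen for the single steps are distinct.\<close>

lemma distinct_consecutive_eq:
  assumes "distinct vs" "Suc i < length vs" "Suc j < length vs"
    and "{vs ! i, vs ! Suc i} = {vs ! j, vs ! Suc j}"
  shows "i = j"
  using assms by (auto simp: doubleton_eq_iff nth_eq_iff_index_eq)

lemma path_last_edge:
  assumes "path B (vs, fs)" "fs \<noteq> []"
  shows "head (last fs) = last vs" "tail (last fs) = last (butlast vs)"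
proof -
  have t: "trail B (vs, fs)" using assms(1) by (simp add: path_def)
  obtain n where n: "length fs = Suc n" using assms(2) by (cases fs) auto
  have "vs \<noteq> []" using trail_nth(1)[OF t] by auto
  then show "head (last fs) = last vs" "tail (last fs) = last (butlast vs)"
    using trail_nth(1,5,6)[OF t] n assms(2)
    by (auto simp: last_conv_nth nth_butlast butlast_conv_take)
qed

lemma path_prefix:
  assumes "path B (vs, fs)" "i \<le> length fs"
  shows "path B (take (Suc i) vs, take i fs)"
proof -
  have t: "trail B (vs, fs)" and "distinct vs" using assms(1) by (auto simp: path_def)
  have "trail B (take (Suc i) vs, take i fs)"
    using t assms(2) trail_nth(1)[OF t] unfolding trail_def
    by (auto simp: take_map[symmetric] dest: in_set_takeD)
  then show ?thesis using \<open>distinct vs\<close> by (simp add: path_def)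
qed

text \<open>The first vertex of the path in \<open>X\<close> lies in \<open>epsilon B r X\<close>,
  witnessed by the initial piece of the path.\<close>

lemma path_meets_epsilon:
  assumes p: "path B p" "joins p r x" and x: "x \<noteq> r"
    and X: "{x} \<union> In_set B r x \<subseteq> X" "X \<subseteq> verts B - {r}"
    and no_edge: "\<not> (\<exists>e \<in> edges B. endpoints B e = {r, x})"
  shows "internal_verts p \<inter> epsilon B r X \<noteq> {}"
proof -
  obtain vs fs where pe: "p = (vs, fs)" by (cases p)
  have t: "trail B (vs, fs)" and d: "distinct vs" using p(1) by (auto simp: path_def pe)
  note n = trail_nth[OF t]
  have "vs \<noteq> []" using n(1) by auto
  then have vs: "vs \<noteq> []" "vs ! 0 = r" "vs ! length fs = x"
    using n(1) p(2) by (simp_all add: joins_def pe hd_conv_nth last_conv_nth)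
  define i where "i = (LEAST i. vs ! i \<in> X)"
  have iX: "vs ! i \<in> X" and ile: "i \<le> length fs"
    unfolding i_def using vs(3) X(1) by (auto intro: LeastI Least_le)
  have "i \<noteq> 0" using iX vs(2) X(2) by (cases i) auto
  then obtain j where j: "i = Suc j" by (cases i) auto
  have jX: "vs ! j \<notin> X" using not_less_Least[of j "\<lambda>i. vs ! i \<in> X"] j by (simp add: i_def)
  have jl: "j < length fs" using ile j by simp
  define f where "f = fs ! j"
  have f: "oriented_edge B f" "tail f = vs ! j" "head f = vs ! i" using n(4-6)[OF jl] j by (auto simp: f_def)
  have "hd (take (Suc i) vs) = r" using vs by (simp add: hd_conv_nth)
  moreover have "last (take i fs) = f" using jl by (simp add: j f_def take_Suc_conv_app_nth)
  ultimately have "path_to_edge B r f (take (Suc i) vs, take i fs)"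
    unfolding path_to_edge_def using path_prefix[OF _ ile, of B vs] p(1) jl j
    by (auto simp: pe trivial_def)
  then have eps: "vs ! i \<in> epsilon B r X" unfolding epsilon_def using f jX iX
    by (intro CollectI conjI exI[of _ f] exI[of _ "(take (Suc i) vs, take i fs)"]) simp_all
  \<comment> \<open>If \<open>X\<close> were entered only at \<open>x\<close>, the preceding vertex
    would be \<open>r\<close>, against \<open>no_edge\<close>, or belong to
    \<open>In_set B r x\<close> and hence to \<open>X\<close>.\<close>
  have "i \<noteq> length fs"
  proof
    assume il: "i = length fs"
    have ne: "fs \<noteq> []" using jl by auto
    then have fx: "head f = x" "last fs = f" "fs \<noteq> []"
      using f(3) il vs(3) by (simp_all add: last_conv_nth f_def il[symmetric] j)
    have "vs ! j \<noteq> r" using f no_edge il vs(3) by (auto simp: oriented_edge_def)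
    moreover have "vs ! j \<noteq> x" using jX X(1) by auto
    moreover have "last (butlast vs) = vs ! j" using path_last_edge(2)[of B vs fs] p(1) pe fx f by simp
    moreover have "vs ! j \<in> verts B" using n(1,2) jl by (auto simp: subset_iff)
    ultimately have "vs ! j \<in> In_set B r x"
      using p fx(3) by (auto simp: In_set_def pe trivial_def intro!: exI[of _ vs] exI[of _ fs])
    then show False using jX X(1) by auto
  qed
  then have "j < length (butlast (tl vs))" using ile j n(1) by simp
  moreover have "butlast (tl vs) ! j = vs ! i" using calculation by (simp add: nth_butlast nth_tl j)
  ultimately have "vs ! i \<in> internal_verts p" by (auto simp: internal_verts_def pe in_set_conv_nth)
  then show ?thesis using eps by auto
qed

section \<open>Paths from the root and sequences of arrival states\<close>

context finite_rooted_bidirected_graph begin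

sublocale skew_digraph "verts B - {r}" "bstep B r" "binit B r"
proof (unfold_locales, goal_cases)
  case 1
  then show ?case using finite_verts by simp
next
  case (2 p q)
  then show ?case using endpoints_subset by (fastforce simp: bstep_def)
next
  case (3 q)
  then show ?case using endpoints_subset by (fastforce simp: binit_def)
next
  case (4 p q)
  then show ?case by (auto simp: bstep_def insert_commute)
qed

lemma path_arrivals:
  assumes "path B (vs, fs)" "hd vs = r" "fs \<noteq> []"
  shows "spath (arrivals B fs)" "binit B r (hd (arrivals B fs))" "map fst (arrivals B fs) = tl vs"
proof -
  have t: "trail B (vs, fs)" and d: "distinct vs" using assms(1) by (auto simp: path_def)
  note n = trail_nth[OF t]
  have "vs \<noteq> []" using n(1) by auto
  then have vs: "vs \<noteq> []" "vs ! 0 = r" using assms(2) by (simp_all add: hd_conv_nth)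
  have vr: "vs ! Suc i \<noteq> r" if "i < length fs" for i
    using nth_eq_iff_index_eq[OF d, of "Suc i" 0] that n(1) vs by auto
  have end_edge: "edge (fs ! i) \<in> edges B" "endpoints B (edge (fs ! i)) = {vs ! i, vs ! Suc i}"
    if "i < length fs" for i using n(4-6)[OF that] by (auto simp: oriented_edge_def)
  have arr: "arrivals B fs ! i = (vs ! Suc i, sign_of B (edge (fs ! i)) (vs ! Suc i))"
    if "i < length fs" for i using that n(6) by (simp add: arrivals_def)
  have len: "length (arrivals B fs) = length fs" by (simp add: arrivals_def)
  show m: "map fst (arrivals B fs) = tl vs"
    by (rule nth_equalityI) (use n(1) arr len in \<open>auto simp: nth_tl\<close>)
  have "bstep B r (arrivals B fs ! i) (arrivals B fs ! Suc i)" if i: "Suc i < length fs" for i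
    unfolding bstep_def using end_edge[OF i] vr[OF i] vr[of i] arr[OF i] arr[of i] n(7)[OF i] i
    by (auto intro!: bexI[of _ "edge (fs ! Suc i)"])
  then have "successively (bstep B r) (arrivals B fs)"
    by (simp add: successively_conv_nth len)
  then show "spath (arrivals B fs)"
    using assms(3) d m len by (auto simp: spath_def distinct_tl)
  have "hd (arrivals B fs) = arrivals B fs ! 0" using assms(3) len by (metis hd_conv_nth length_0_conv)
  moreover have "0 < length fs" using assms(3) by simp
  ultimately show "binit B r (hd (arrivals B fs))"
    unfolding binit_def using end_edge[of 0] vr[of 0] arr[of 0] vs(2)
    by (auto intro!: bexI[of _ "edge (fs ! 0)"])
qed

lemma spath_path:
  assumes P: "spath P" "binit B r (hd P)"
  shows "\<exists>fs. path B (r # map fst P, fs) \<and> arrivals B fs = P"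
proof -
  let ?vs = "r # map fst P"
  have ne: "P \<noteq> []" using P(1) by (simp add: spath_def)
  have step: "bstep B r (P ! i) (P ! Suc i)" if "Suc i < length P" for i
    using P(1) that by (simp add: spath_def successively_conv_nth)
  have "\<exists>f. oriented_edge B f \<and> tail f = ?vs ! i \<and> head f = fst (P ! i) \<and>
      sign_of B (edge f) (head f) = snd (P ! i) \<and>
      (\<forall>j. i = Suc j \<longrightarrow> sign_of B (edge f) (tail f) = opposite (snd (P ! j)))" if i: "i < length P" for i
  proof (cases i)
    case 0
    have "hd P = P ! 0" using ne by (simp add: hd_conv_nth)
    then obtain e where "e \<in> edges B" "endpoints B e = {r, fst (P ! 0)}" "sign_of B e (fst (P ! 0)) = snd (P ! 0)"
      using P(2) by (auto simp: binit_def)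
    then show ?thesis using 0 by (intro exI[of _ "Oriented e r (fst (P ! 0))"]) (auto simp: oriented_edge_def)
  next
    case (Suc j)
    then obtain e where "e \<in> edges B" "endpoints B e = {fst (P ! j), fst (P ! i)}"
      "sign_of B e (fst (P ! j)) = opposite (snd (P ! j))" "sign_of B e (fst (P ! i)) = snd (P ! i)"
      using step[of j] i by (auto simp: bstep_def)
    then show ?thesis using Suc i
      by (intro exI[of _ "Oriented e (fst (P ! j)) (fst (P ! i))"]) (auto simp: oriented_edge_def)
  qed
  then obtain F where F: "\<And>i. i < length P \<Longrightarrow> oriented_edge B (F i)"
    "\<And>i. i < length P \<Longrightarrow> tail (F i) = ?vs ! i"
    "\<And>i. i < length P \<Longrightarrow> head (F i) = fst (P ! i)"
    "\<And>i. i < length P \<Longrightarrow> sign_of B (edge (F i)) (head (F i)) = snd (P ! i)"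
    "\<And>i. Suc i < length P \<Longrightarrow> sign_of B (edge (F (Suc i))) (tail (F (Suc i))) = opposite (snd (P ! i))"
    by metis
  define fs where "fs = map F [0..<length P]"
  have arr: "arrivals B fs = P"
    by (rule nth_equalityI) (use F(3,4) in \<open>simp_all add: arrivals_def fs_def prod_eq_iff\<close>)
  have inV: "fst q \<in> verts B - {r}" if q: "q \<in> set P" for q
  proof -
    obtain i where i: "i < length P" "q = P ! i" using q by (auto simp: in_set_conv_nth)
    show ?thesis
    proof (cases i)
      case 0
      then show ?thesis using init_V[OF P(2)] i ne by (simp add: hd_conv_nth)
    next
      case (Suc j)
      then show ?thesis using step_V[OF step[of j]] i by simp
    qed
  qed
  then have d: "distinct ?vs" using P(1) by (auto simp: spath_def)
  have ends: "endpoints B (edge (F i)) = {?vs ! i, ?vs ! Suc i}" if "i < length P" for i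
    using F(1-3)[OF that] that by (simp add: oriented_edge_def)
  have "i = j" if ij: "i < length P" "j < length P" "edge (F i) = edge (F j)" for i j
  proof (rule distinct_consecutive_eq[OF d])
    show "{?vs ! i, ?vs ! Suc i} = {?vs ! j, ?vs ! Suc j}" using ends ij by metis
  qed (use ij in simp_all)
  then have de: "distinct (map edge fs)"
    by (auto simp: fs_def distinct_map inj_on_def)
  have "trail B (?vs, fs)"
    unfolding trail_def prod.case
  proof (intro conjI allI impI)
    show "length ?vs = Suc (length fs)" by (simp add: fs_def)
    show "set ?vs \<subseteq> verts B" using inV root by auto
    show "distinct (map edge fs)" by (rule de)
    show "oriented_edge B (fs ! i)" "tail (fs ! i) = ?vs ! i" "head (fs ! i) = ?vs ! Suc i"
      if "i < length fs" for i using that F(1-3)[of i] by (simp_all add: fs_def)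
    show "sign_of B (edge (fs ! i)) (?vs ! i) = opposite (sign_of B (edge (fs ! (i - 1))) (?vs ! i))"
      if i: "1 \<le> i \<and> i < length fs" for i
    proof -
      obtain j where j: "i = Suc j" using i by (cases i) auto
      show ?thesis using i F(2)[of i] F(3,4)[of j] F(5)[of j] by (simp add: fs_def j)
    qed
  qed
  then show ?thesis using d arr by (auto simp: path_def)
qed

lemma clean_imp_clean_init:
  assumes "clean B r"
  shows clean_init
  unfolding clean_init_def
proof (intro allI impI notI)
  fix P assume P: "spath P" "binit B r (hd P)" "binit B r (neg (last P))"
  obtain fs where fs: "path B (r # map fst P, fs)" "arrivals B fs = P" using spath_path[OF P(1,2)] by blast
  let ?vs = "r # map fst P" and ?v = "fst (last P)"
  have ne: "P \<noteq> []" using P(1) by (simp add: spath_def)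
  obtain e where e: "e \<in> edges B" "endpoints B e = {r, ?v}" "sign_of B e ?v = opposite (snd (last P))"
    using P(3) by (auto simp: binit_def)
  have t: "trail B (?vs, fs)" and d: "distinct ?vs" using fs(1) by (auto simp: path_def)
  note n = trail_nth[OF t]
  have len: "length fs = length P" using n(1) by simp
  have v: "?vs ! length P = ?v" using ne by (simp add: last_conv_nth nth_Cons')
  obtain k where k: "length P = Suc k" using ne by (cases P) auto
  have sgn: "sign_of B (edge (fs ! k)) ?v = snd (last P)"
  proof -
    have "(head (fs ! k), sign_of B (edge (fs ! k)) (head (fs ! k))) = P ! k"
      using fs(2) len k by (metis (no_types, lifting) arrivals_def lessI nth_map)
    moreover have "P ! k = last P" using k ne by (simp add: last_conv_nth)
    ultimately show ?thesis by (metis fst_conv snd_conv)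
  qed
  \<comment> \<open>An earlier use of \<open>e\<close> would join the first and last vertices of a
    path, so it would be the last edge of \<open>fs\<close>; but that edge has the opposite sign at
    \<open>?v\<close>.\<close>
  have new: "edge (fs ! i) \<noteq> e" if i: "i < length fs" for i
  proof
    assume ei: "edge (fs ! i) = e"
    have "{?vs ! i, ?vs ! Suc i} = {?vs ! 0, ?vs ! length P}"
      using n(4-6)[OF i] ei e(2) v by (simp add: oriented_edge_def)
    moreover have "?vs ! k = ?vs ! l \<Longrightarrow> k = l" if "k \<le> length P" "l \<le> length P" for k l
      using nth_eq_iff_index_eq[OF d, of k l] that by simp
    ultimately have "Suc i = length P" using i len unfolding doubleton_eq_iff
      by (metis Suc_leI less_imp_le_nat order_refl less_irrefl)
    then have "i = k" using k by simp
    then show False using ei e(3) sgn by (cases "snd (last P)") auto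
  qed
  let ?ws = "?vs @ [r]" and ?gs = "fs @ [Oriented e ?v r]"
  have "trail B (?ws, ?gs)"
    unfolding trail_def prod.case
  proof (intro conjI allI impI)
    show "length ?ws = Suc (length ?gs)" using n(1) by simp
    show "set ?ws \<subseteq> verts B" using n(2) root by auto
    show "distinct (map edge ?gs)" using n(3) new by (fastforce simp: in_set_conv_nth)
  next
    fix i assume i: "i < length ?gs"
    have "oriented_edge B (?gs ! i) \<and> tail (?gs ! i) = ?ws ! i \<and> head (?gs ! i) = ?ws ! Suc i"
    proof (cases "i < length fs")
      case True
      then have "?gs ! i = fs ! i" "?ws ! i = ?vs ! i" "?ws ! Suc i = ?vs ! Suc i"
        using len by (simp_all only: nth_append length_Cons length_map) simp_all
      then show ?thesis using n(4-6)[OF True] by simp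
    next
      case False
      then have il: "i = length fs" using i by simp
      then have "?gs ! i = Oriented e ?v r" "?ws ! i = ?v" "?ws ! Suc i = r"
        using len v nth_append[of ?vs "[r]" i] nth_append[of ?vs "[r]" "Suc i"] nth_append_length[of fs]
        by simp_all
      then show ?thesis using e by (simp add: oriented_edge_def insert_commute)
    qed
    then show "oriented_edge B (?gs ! i)" "tail (?gs ! i) = ?ws ! i" "head (?gs ! i) = ?ws ! Suc i" by auto
  next
    fix i assume i: "1 \<le> i \<and> i < length ?gs"
    then obtain j where j: "i = Suc j" by (cases i) auto
    show "sign_of B (edge (?gs ! i)) (?ws ! i) = opposite (sign_of B (edge (?gs ! (i - 1))) (?ws ! i))"
    proof (cases "i < length fs")
      case True
      then have "?gs ! i = fs ! i" "?gs ! j = fs ! j" "?ws ! i = ?vs ! i"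
        using len j nth_append[of ?vs "[r]" i] by (simp_all add: nth_append)
      then show ?thesis using n(7)[of j] True j by simp
    next
      case False
      then have il: "i = length fs" "j = k" using i j len k by simp_all
      then have "?gs ! i = Oriented e ?v r" "?ws ! i = ?v" "?gs ! j = fs ! k"
        using len v k nth_append[of ?vs "[r]" i] by (simp_all add: nth_append)
      then show ?thesis using e(3) sgn j by simp
    qed
  qed
  then have "almost_path B (?ws, ?gs)" using fs(1) by (simp add: almost_path_def butlast_append)
  moreover have "joins (?ws, ?gs) r r" "\<not> trivial (?ws, ?gs)" by (auto simp: joins_def trivial_def)
  ultimately show False using assms unfolding clean_def by blast
qed

end

section \<open>Blossoms and the last edges of paths from the root\<close>

locale rooted_blossoms = finite_rooted_bidirected_graph B r +
  closed_blossoms "verts B - {r}" "bstep B r" "binit B r" W b s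
  for B :: "('v, 'e) bidirected" and r W b s
begin

text \<open>The path contains the base of each fibre that it visits, so its last edge cannot lead
  back to the base of the fibre it starts in. Closedness leaves just these cases, which govern both
  \<open>epsilon\<close> and \<open>In_set\<close>.\<close>

lemma path_to_edge_blossoms:
  assumes "path_to_edge B r f p"
  shows "head f \<in> W"
    and "tail f = r \<and> b (head f) = head f \<and> binit B r (head f, s (head f)) \<or>
      tail f \<in> W \<and> (b (head f) = b (tail f) \<and> b (head f) \<noteq> head f \<or>
        b (head f) = head f \<and> b (tail f) \<noteq> head f \<and> arc W b s (b (tail f)) (head f))"
proof -
  obtain vs fs where pe: "p = (vs, fs)" by (cases p)
  have p: "path B (vs, fs)" "hd vs = r" "fs \<noteq> []" "last fs = f"
    using assms by (auto simp: path_to_edge_def pe trivial_def)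
  note a = path_arrivals[OF p(1-3)]
  define q where "q = (head f, sign_of B (edge f) (head f))"
  have split: "arrivals B fs = arrivals B (butlast fs) @ [q]"
    using p(3,4) by (cases fs rule: rev_cases) (auto simp: arrivals_def q_def)
  define Q where "Q = arrivals B (butlast fs)"
  have aQ: "arrivals B fs = Q @ [q]" by (simp add: Q_def split)
  have vs: "vs \<noteq> []" using trail_nth(1)[of B vs fs] p(1) by (auto simp: path_def)
  have "map fst Q = butlast (tl vs)" using arg_cong[OF a(3), of butlast] aQ by simp
  moreover have "vs = r # tl vs" using vs p(2) by (cases vs) auto
  moreover have "tl vs \<noteq> []" using a(3) aQ by (cases "tl vs") auto
  ultimately have bvs: "butlast vs = r # map fst Q" by (metis butlast.simps(2))
  have tl: "tail f = last (r # map fst Q)" using path_last_edge(2)[OF p(1,3)] p(4) bvs by simp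
  have h: "head f = fst q" by (simp add: q_def)
  show "head f \<in> W"
    and "tail f = r \<and> b (head f) = head f \<and> binit B r (head f, s (head f)) \<or>
      tail f \<in> W \<and> (b (head f) = b (tail f) \<and> b (head f) \<noteq> head f \<or>
        b (head f) = head f \<and> b (tail f) \<noteq> head f \<and> arc W b s (b (tail f)) (head f))"
  proof (atomize(full), cases "Q = []")
    case True
    then have "binit B r q" using a(2) aQ by simp
    then show "head f \<in> W \<and> (tail f = r \<and> b (head f) = head f \<and> binit B r (head f, s (head f)) \<or>
      tail f \<in> W \<and> (b (head f) = b (tail f) \<and> b (head f) \<noteq> head f \<or>
        b (head f) = head f \<and> b (tail f) \<noteq> head f \<and> arc W b s (b (tail f)) (head f)))"
      using init_closed[of q] True tl h by (metis last.simps list.map_disc_iff prod.collapse)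
  next
    case False
    have Q: "spath Q" "bstep B r (last Q) q" "fst q \<notin> fst ` set Q" "binit B r (hd Q)"
      using a(1,2) aQ False by (auto simp: spath_def successively_append_iff)
    note resp = spath_respects[OF Q(1,4)]
    have l: "last Q \<in> set Q" "tail f = fst (last Q)" using False tl by (auto simp: last_map)
    then have o: "last Q \<in> outer W b s" using resp by auto
    have "b (tail f) \<in> fst ` set Q" using resp(2) l by auto
    then have ne: "b (tail f) \<noteq> head f" using Q(3) h by metis
    have tW: "tail f \<in> W" using o l(2) by (auto simp: outer_def)
    note cl = step_closed[OF o Q(2)]
    show "head f \<in> W \<and> (tail f = r \<and> b (head f) = head f \<and> binit B r (head f, s (head f)) \<or>
      tail f \<in> W \<and> (b (head f) = b (tail f) \<and> b (head f) \<noteq> head f \<or>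
        b (head f) = head f \<and> b (tail f) \<noteq> head f \<and> arc W b s (b (tail f)) (head f)))"
    proof (cases "b (head f) = b (tail f)")
      case True
      then show ?thesis using cl ne tW h by auto
    next
      case False
      then have bh: "b (head f) = head f" "snd q = s (head f)" using cl h l(2) by auto
      then have "q = (head f, s (head f))" by (simp add: h prod_eq_iff)
      then have "arc W b s (b (tail f)) (head f)"
        unfolding arc_def using cl bh o Q(2) l(2) h by auto
      then show ?thesis using cl bh ne tW h by auto
    qed
  qed
qed

lemma In_set_blossoms:
  assumes "v \<in> In_set B r x"
  shows "v \<in> W" "x \<in> W" "b x = b v \<and> b x \<noteq> x \<or> b x = x \<and> b v \<noteq> x \<and> arc W b s (b v) x"
proof -
  obtain p where p: "path B p" "joins p r x" "\<not> trivial p" "last (butlast (fst p)) = v"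
    and vr: "v \<noteq> r" using assms by (auto simp: In_set_def)
  obtain vs fs where pe: "p = (vs, fs)" by (cases p)
  have "path_to_edge B r (last fs) p" using p by (auto simp: path_to_edge_def joins_def pe)
  moreover have "head (last fs) = x" "tail (last fs) = v"
    using path_last_edge[of B vs fs] p by (auto simp: pe trivial_def joins_def)
  ultimately show "v \<in> W" "x \<in> W" "b x = b v \<and> b x \<noteq> x \<or> b x = x \<and> b v \<noteq> x \<and> arc W b s (b v) x"
    using path_to_edge_blossoms[of "last fs" p] vr by auto
qed

end

context rooted_blossoms begin

text \<open>A path system and a set \<open>X\<close> of matching size fix both extrema at once,
  since the other inequality holds for every such pair.\<close>

lemma certificate:
  assumes x: "x \<in> verts B - {r}" and no_edge: "\<not> (\<exists>e \<in> edges B. endpoints B e = {r, x})"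
  shows "\<exists>P X. finite P \<and> (\<forall>p\<in>P. path B p \<and> joins p r x) \<and>
    pairwise (\<lambda>p q. internal_verts p \<inter> internal_verts q = {}) P \<and>
    {x} \<union> In_set B r x \<subseteq> X \<and> X \<subseteq> verts B - {r} \<and> card (epsilon B r X) \<le> card P"
proof -
  have epsD: "v \<in> X \<and> v \<in> W \<and> (\<exists>u. u \<notin> X \<and>
      (u = r \<and> b v = v \<and> binit B r (v, s v) \<or>
       u \<in> W \<and> (b v = b u \<and> b v \<noteq> v \<or> b v = v \<and> b u \<noteq> v \<and> arc W b s (b u) v)))"
    if "v \<in> epsilon B r X" for v X
    using that path_to_edge_blossoms unfolding epsilon_def by blast
  consider "x \<notin> W" | "x \<in> W" "b x \<noteq> x" | "x \<in> W" "b x = x" by blast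
  then show ?thesis
  proof cases
    case 1
    have "In_set B r x = {}" using In_set_blossoms(2) 1 by blast
    moreover have "epsilon B r {x} = {}" using epsD 1 by blast
    ultimately show ?thesis using x by (intro exI[of _ "{}"] exI[of _ "{x}"]) simp
  next
    case 2
    let ?X = "{v \<in> W. b v = b x}"
    have "(x, Plus) \<in> outer W b s" using 2 by (simp add: outer_def)
    then obtain Q where Q: "spath Q" "binit B r (hd Q)" "last Q = (x, Plus)"
      using lift_from_init by blast
    obtain fs where fs: "path B (r # map fst Q, fs)" using spath_path[OF Q(1,2)] by blast
    have "Q \<noteq> []" using Q(1) by (simp add: spath_def)
    then have "joins (r # map fst Q, fs) r x" using Q(3) by (simp add: joins_def last_map)
    \<comment> \<open>Entering the fibre from outside is possible only at its base, so a single path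
      is already optimal.\<close>
    moreover have "epsilon B r ?X \<subseteq> {b x}"
    proof
      fix v assume "v \<in> epsilon B r ?X"
      from epsD[OF this] show "v \<in> {b x}" by auto
    qed
    then have "card (epsilon B r ?X) \<le> 1" using card_mono[of "{b x}"] by fastforce
    moreover have "In_set B r x \<subseteq> ?X" using In_set_blossoms 2(2) by fastforce
    moreover have "?X \<subseteq> verts B - {r}" using W_V by blast
    ultimately show ?thesis using fs 2
      by (intro exI[of _ "{(r # map fst Q, fs)}"] exI[of _ ?X]) simp
  next
    case 3
    define N where "N = {c \<in> W. b c = c \<and> c \<noteq> x}"
    \<comment> \<open>Without \<open>x\<close> no path can pass through the target. Loops are
      dropped: they arise from steps that return to the base of their own fibre.\<close>
    define E where "E = {(c, d). c \<in> N \<and> d \<in> N \<and> c \<noteq> d \<and> arc W b s c d}"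
    define A where "A = {c \<in> N. binit B r (c, s c)}"
    define T where "T = {c \<in> N. arc W b s c x}"
    have finW: "finite W" using finite_subset[OF W_V] finite_verts by simp
    have "E \<subseteq> W \<times> W" "A \<subseteq> W" by (auto simp: E_def N_def A_def)
    then have fin: "finite E" "finite A" using finW by (auto intro: finite_subset)
    have "irrefl E" by (auto simp: irrefl_def E_def)
    have AE: "A \<union> Range E \<subseteq> N" by (auto simp: A_def E_def)
    obtain \<P> S where \<P>: "disjoint_paths E A T \<P>"
      and S: "separates E A T S" "finite S" "card \<P> = card S" using menger[OF fin \<open>irrefl E\<close>] by metis
    \<comment> \<open>Nonempty interiors are recorded because disjoint interiors tell two paths
      apart only if they are nonempty; this makes \<open>g\<close> injective.\<close>
    have "\<exists>p. path B p \<and> joins p r x \<and> internal_verts p \<noteq> {} \<and>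
      internal_verts p \<subseteq> {w \<in> W. b w \<in> set cs}" if "cs \<in> \<P>" for cs
    proof -
      have cs: "cs \<noteq> []" "hd cs \<in> A" "last cs \<in> T" "distinct cs" "successively (\<lambda>c d. (c, d) \<in> E) cs"
        using \<P> that by (auto simp: disjoint_paths_def walk_def)
      have chain: "successively (arc W b s) cs"
        using cs(5) by (rule successively_mono) (auto simp: E_def)
      have hdcs: "hd cs \<in> W" "b (hd cs) = hd cs" "binit B r (hd cs, s (hd cs))"
        using cs(2) by (auto simp: A_def N_def)
      obtain q where q: "q \<in> outer W b s" "b (fst q) = last cs" "bstep B r q (x, s x)"
        using cs(3) by (auto simp: T_def arc_def)
      obtain Q where Q: "spath Q" "hd Q = (hd cs, s (hd cs))" "last Q = q"
        "fst ` set Q \<subseteq> {w \<in> W. b w \<in> set cs}"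
        using lift[OF chain cs(1,4) hdcs(1,2) q(1,2)] by blast
      have "set cs \<subseteq> N" using walk_set \<P> that AE by (fastforce simp: disjoint_paths_def)
      then have "x \<notin> fst ` set Q" using Q(4) 3 by (auto simp: N_def)
      then have "spath (Q @ [(x, s x)])"
        using spath_append[OF Q(1), of "[(x, s x)]"] q(3) Q(3) by (simp add: spath_def)
      moreover have ne: "Q \<noteq> []" using Q(1) by (simp add: spath_def)
      moreover have "binit B r (hd (Q @ [(x, s x)]))" using ne Q(2) hdcs(3) by simp
      ultimately obtain fs where fs: "path B (r # map fst (Q @ [(x, s x)]), fs)"
        using spath_path by blast
      have int: "internal_verts (r # map fst (Q @ [(x, s x)]), fs) = fst ` set Q"
        by (simp add: internal_verts_def)
      show ?thesis
        by (rule exI[of _ "(r # map fst (Q @ [(x, s x)]), fs)"], unfold int)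
          (use fs ne Q(4) in \<open>simp add: joins_def\<close>)
    qed
    then obtain g where g: "\<And>cs. cs \<in> \<P> \<Longrightarrow> path B (g cs)" "\<And>cs. cs \<in> \<P> \<Longrightarrow> joins (g cs) r x"
      "\<And>cs. cs \<in> \<P> \<Longrightarrow> internal_verts (g cs) \<noteq> {}"
      "\<And>cs. cs \<in> \<P> \<Longrightarrow> internal_verts (g cs) \<subseteq> {w \<in> W. b w \<in> set cs}" by metis
    have gdisj: "internal_verts (g c) \<inter> internal_verts (g d) = {}"
      if "c \<in> \<P>" "d \<in> \<P>" "c \<noteq> d" for c d
    proof -
      have "set c \<inter> set d = {}" using \<P> that by (auto simp: disjoint_paths_def pairwise_def)
      then show ?thesis using g(4)[OF that(1)] g(4)[OF that(2)] by blast
    qed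
    have "inj_on g \<P>" by (rule inj_onI) (metis gdisj g(3) Int_absorb)
    then have card: "card (g ` \<P>) = card S" using S(3) by (simp add: card_image)
    define Z where "Z = {c. \<exists>p. walk E A {c} p \<and> set p \<inter> S = {}}"
    have ZN: "c \<in> N" if "c \<in> Z" for c
    proof -
      have "\<exists>p. walk E A {c} p" using that by (auto simp: Z_def)
      then obtain p where p: "walk E A {c} p" by blast
      then have "c \<in> set p" by (auto simp: walk_def)
      then show ?thesis using walk_set[OF p] AE by blast
    qed
    have Z_step: "d \<in> Z" if cd: "c \<in> Z" "d \<in> N" "arc W b s c d" "d \<notin> S" for c d
    proof (cases "c = d")
      case False
      obtain p where p: "walk E A {c} p" "set p \<inter> S = {}" using cd(1) by (auto simp: Z_def)
      have "(c, d) \<in> E" using cd False ZN by (simp add: E_def)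
      then have "walk E A {d} (p @ [d])" using p(1) by (auto simp: walk_def successively_append_iff)
      then show ?thesis using p(2) cd(4) by (auto simp: Z_def intro!: exI[of _ "p @ [d]"])
    qed (use cd in simp)
    have Z_init: "c \<in> Z" if "c \<in> A" "c \<notin> S" for c
      using that by (auto simp: Z_def walk_def intro!: exI[of _ "[c]"])
    have ZT: "c \<notin> T" if "c \<in> Z" for c
      using that S(1) by (auto simp: Z_def separates_def walk_def)
    have Zx: "\<not> arc W b s c x" if "c \<in> Z" for c using ZT ZN that by (auto simp: T_def)
    \<comment> \<open>Vertices outside \<open>W\<close> are also put into \<open>X\<close>; no path
      from the root arrives there, so they add nothing to \<open>epsilon B r X\<close>.\<close>
    define X where "X = {v \<in> verts B - {r}. \<not> (v \<in> W \<and> b v \<in> Z)}"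
    have notX: "b u \<in> Z" if "u \<notin> X" "u \<in> W" for u using that W_V by (auto simp: X_def)
    have xX: "x \<in> X" using x 3 ZN[of x] by (auto simp: X_def N_def)
    have InX: "In_set B r x \<subseteq> X"
    proof
      fix v assume v: "v \<in> In_set B r x"
      then have "arc W b s (b v) x" using In_set_blossoms(3) 3 by blast
      moreover have "v \<in> verts B - {r}" using v by (simp add: In_set_def)
      ultimately show "v \<in> X" using Zx by (auto simp: X_def)
    qed
    have "epsilon B r X \<subseteq> S"
    proof
      fix v assume "v \<in> epsilon B r X"
      then obtain u where v: "v \<in> X" "v \<in> W" "u \<notin> X"
        and u: "u = r \<and> b v = v \<and> binit B r (v, s v) \<or>
          u \<in> W \<and> (b v = b u \<and> b v \<noteq> v \<or> b v = v \<and> b u \<noteq> v \<and> arc W b s (b u) v)"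
        using epsD by blast
      have bv: "b v \<notin> Z" using v by (simp add: X_def)
      from u show "v \<in> S"
      proof (elim disjE conjE)
        assume i: "b v = v" "binit B r (v, s v)"
        have "v \<noteq> x" using i(2) no_edge by (auto simp: binit_def)
        then have "v \<in> A" using i v by (simp add: A_def N_def)
        then show ?thesis using Z_init bv i(1) by auto
      next
        assume "u \<in> W" "b v = b u"
        then show ?thesis using notX[OF v(3)] bv by simp
      next
        assume i: "u \<in> W" "b v = v" "arc W b s (b u) v"
        have bu: "b u \<in> Z" using notX[OF v(3) i(1)] .
        then have "v \<noteq> x" using Zx i(3) by blast
        then have "v \<in> N" using i v by (simp add: N_def)
        then show ?thesis using Z_step[OF bu _ i(3)] bv i(2) by auto
      qed
    qed
    then have "card (epsilon B r X) \<le> card (g ` \<P>)" using S(2) card by (simp add: card_mono)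
    moreover have "finite (g ` \<P>)" using \<P> by (simp add: disjoint_paths_def)
    moreover have "pairwise (\<lambda>p q. internal_verts p \<inter> internal_verts q = {}) (g ` \<P>)"
      using gdisj by (auto simp: pairwise_def)
    moreover have "\<forall>p\<in>g ` \<P>. path B p \<and> joins p r x" using g by blast
    moreover have "X \<subseteq> verts B - {r}" by (auto simp: X_def)
    ultimately show ?thesis using xX InX by (intro exI[of _ "g ` \<P>"] exI[of _ X]) simp
  qed
qed

end

context finite_rooted_bidirected_graph begin

lemma finite_epsilon: "X \<subseteq> verts B - {r} \<Longrightarrow> finite (epsilon B r X)"
  using finite_verts by (auto simp: epsilon_def intro: finite_subset[of _ "verts B"])

text \<open>Picking on each path an internal vertex in \<open>epsilon B r X\<close> is injective, as
  the interiors are disjoint.\<close>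

lemma disjoint_paths_le_epsilon:
  assumes x: "x \<in> verts B - {r}" and no_edge: "\<not> (\<exists>e \<in> edges B. endpoints B e = {r, x})"
    and X: "{x} \<union> In_set B r x \<subseteq> X" "X \<subseteq> verts B - {r}"
    and P: "finite P" "\<forall>p\<in>P. path B p \<and> joins p r x"
      "pairwise (\<lambda>p q. internal_verts p \<inter> internal_verts q = {}) P"
  shows "card P \<le> card (epsilon B r X)"
proof -
  have "\<exists>v. v \<in> internal_verts p \<and> v \<in> epsilon B r X" if "p \<in> P" for p
    using path_meets_epsilon[OF _ _ _ X no_edge, of p] P(2) that x by auto
  then obtain h where h: "\<And>p. p \<in> P \<Longrightarrow> h p \<in> internal_verts p" "\<And>p. p \<in> P \<Longrightarrow> h p \<in> epsilon B r X"
    by metis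
  have "inj_on h P"
  proof (rule inj_onI, rule ccontr)
    fix p q assume pq: "p \<in> P" "q \<in> P" "h p = h q" "p \<noteq> q"
    then have "internal_verts p \<inter> internal_verts q = {}" using P(3) by (auto simp: pairwise_def)
    then show False using h(1)[OF pq(1)] h(1)[OF pq(2)] pq(3) by auto
  qed
  then show ?thesis using h(2) finite_epsilon[OF X(2)] by (auto intro: card_inj_on_le)
qed

end

theorem theorem7p8:
  fixes B :: "('v, 'e) bidirected" and r x :: 'v
  assumes "finite_rooted_bidirected_graph B r"
    and "clean B r"
    and "x \<in> verts B - {r}"
    and "\<not> (\<exists>e \<in> edges B. endpoints B e = {r, x})"
  shows "kappa B r x =
    Min {card (epsilon B r X) | X. {x} \<union> In_set B r x \<subseteq> X \<and> X \<subseteq> verts B - {r}}"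
proof -
  interpret finite_rooted_bidirected_graph B r by (rule assms(1))
  obtain W b s where "closed_blossoms (verts B - {r}) (bstep B r) (binit B r) W b s"
    using closed_blossoms_exist[OF clean_imp_clean_init[OF assms(2)]] by blast
  then interpret rooted_blossoms B r W b s
    by (simp add: rooted_blossoms_def assms(1))
  note le = disjoint_paths_le_epsilon[OF assms(3,4)]
  obtain P X where P: "finite P" "\<forall>p\<in>P. path B p \<and> joins p r x"
      "pairwise (\<lambda>p q. internal_verts p \<inter> internal_verts q = {}) P"
    and X: "{x} \<union> In_set B r x \<subseteq> X" "X \<subseteq> verts B - {r}" "card (epsilon B r X) \<le> card P"
    using certificate[OF assms(3,4)] by blast
  have eq: "card (epsilon B r X) = card P" using le[OF X(1,2) P] X(3) by simp
  have "kappa B r x = card P"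
    unfolding kappa_def
  proof (rule Max_eqI)
    let ?K = "{card P | P. finite P \<and> (\<forall>p\<in>P. path B p \<and> joins p r x) \<and>
      pairwise (\<lambda>p q. internal_verts p \<inter> internal_verts q = {}) P}"
    \<comment> \<open>The upper bound also supplies the finiteness that \<open>Max\<close> depends
      on.\<close>
    show bound: "k \<le> card P" if "k \<in> ?K" for k using that le[OF X(1,2)] eq by auto
    then show "finite ?K" by (meson finite_nat_set_iff_bounded_le)
    show "card P \<in> ?K" using P by blast
  qed
  moreover have "Min {card (epsilon B r X) | X. {x} \<union> In_set B r x \<subseteq> X \<and> X \<subseteq> verts B - {r}} = card P"
  proof (rule Min_eqI)
    let ?M = "{card (epsilon B r X) | X. {x} \<union> In_set B r x \<subseteq> X \<and> X \<subseteq> verts B - {r}}"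
    have "?M \<subseteq> (\<lambda>X. card (epsilon B r X)) ` Pow (verts B - {r})" by auto
    then show "finite ?M" using finite_verts by (auto intro: finite_subset)
    show "card P \<le> m" if "m \<in> ?M" for m using that le[OF _ _ P] by auto
    show "card P \<in> ?M" using X eq by (intro CollectI exI[of _ X]) simp
  qed
  ultimately show ?thesis by simp
qed

end
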